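(* Consider the linear Gaussian state space system $X_n=A_nX_{n-1}+Q_n^{1/2}W_n$, $Y_n=H_nX_n+R_n^{1/2}V_n$ ($n\ge1$) described in the context, with initial density $p(x_0)=n(x_0;m_0,P_0)$, and suppose that the observation covariance is block diagonal, $R_n=\mathrm{diag}(\{R_{b,n}\}_{b=1}^B)$ with $B\in\{1,\dots,d_Y\}$, $R_{b,n}\in\mathbb{R}^{d_b\times d_b}$, $\sum_{b=1}^Bd_b=d_Y$. Let $q_b^2>0$ for $b\in\{1,\dots,B\}$, let $y_1,y_2,\ldots\in\mathbb{R}^{d_Y}$ be an arbitrary observation sequence, and assume that at every time $n$ the true data generating density $\pi_n$ of the observation satisfies the regularity conditions (stated in the context). Then the corresponding (block) diffusion score matching filtering equations (stated in the context) can be evaluated in closed form and the resulting distributions are Gaussian for every $n\ge1$: $$p(x_n|y_{1:(n-1)})=n(x_n;m_n^f,P_n^f),\quad p(y_n|y_{1:(n-1)})=n(y_n;H_nm_n^f,\Sigma_n),\quad p_{\mathrm{DSM}}(x_n|y_{1:n})=n(x_n;m_n^a,P_n^a),$$ with parameters given by the recursion started from $m_0^a=m_0$, $P_0^a=P_0$: Forecast: $P_n^f=A_nP_{n-1}^aA_n^T+Q_n$ and $m_n^f=A_nm_{n-1}^a$. Analysis: $\Sigma_n=H_nP_n^fH_n^T+R_n$; for each $b\in\{1,\dots,B\}$, $$k_{b,n}(y)=\left(1+\frac{\left\|\left[\Sigma_n^{-1/2}(y-H_nm_n^f)\right]_b\right\|^2}{q_b^2}\right)^{-1/2},\qquad N_{b,n}(y_n)=\frac{1}{2k_{b,n}^2(y_n)}R_{b,n};$$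 $$k_{(B),n}(y)=\mathrm{diag}\left(\{k_{b,n}(y)\mathbf{1}_{d_b\times d_b}\}_{b=1}^B\right),\qquad N_{(B),n}(y_n)=\mathrm{diag}\left(\{N_{b,n}(y_n)\}_{b=1}^B\right),$$ $$\tilde y_n=y_n-2N_{(B),n}(y_n)\,\nabla_{y_n}\cdot k_{(B),n}^2(y_n),\qquad \widetilde K_n(y_n)=P_n^fH_n^T\left[N_{(B),n}(y_n)+H_nP_n^fH_n^T\right]^{-1},$$ $$P_n^a=P_n^f-\widetilde K_n(y_n)H_nP_n^f,\qquad m_n^a=m_n^f-\widetilde K_n(y_n)\left[H_nm_n^f-\tilde y_n\right].$$
   Context: $n(x;m,P)$ denotes the density of the multivariate Gaussian distribution with mean $m$ and covariance $P$. $\mathbf{1}_{d\times d}$ is the identity matrix. The blocks partition the indices $\{1,\dots,d_Y\}$, and $[v]_b\in\mathbb{R}^{d_b}$ is the subvector of $v\in\mathbb{R}^{d_Y}$ with the indices of block $b$. $\mathrm{diag}(\cdot)$ forms a block diagonal matrix. $\Sigma_n^{-1/2}$ and $R_n^{1/2}$ are symmetric positive definite square roots. For the diagonal matrix function $M=k_{(B),n}^2$, $\nabla_y\cdot M$ is the row-wise divergence, i.e. the vector with $i$-th entry $\partial_{y_i}M_{ii}(y)$. System: $X_n$ is $\mathbb{R}^{d_X}$-valued, $Y_n$ is $\mathbb{R}^{d_Y}$-valued, $W_n$ and $V_n$ are independent standard Gaussian vectors, $A_n\in\mathbb{R}^{d_X\times d_X}$, $H_n\in\mathbb{R}^{d_Y\times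 d_X}$, $Q_n$ and $R_n$ are symmetric positive definite, $P_0$ is a covariance matrix. Thus $p(x_n|x_{n-1})=n(x_n;A_nx_{n-1},Q_n)$ and $p(y_n|x_n)=n(y_n;H_nx_n,R_n)$. Diffusion score matching filtering equations: $p_{\mathrm{DSM}}(x_0)=p(x_0)$ and, recursively for $n\ge1$, $$p(x_n|y_{1:(n-1)})=\int p(x_n|x_{n-1})\,p_{\mathrm{DSM}}(x_{n-1}|y_{1:(n-1)})\,\mathrm{d}x_{n-1},$$ $$p(y_n|y_{1:(n-1)})=\int p(y_n|x_n)\,p(x_n|y_{1:(n-1)})\,\mathrm{d}x_n,$$ $$p_{\mathrm{DSM}}(x_n|y_{1:n})\propto p(x_n|y_{1:(n-1)})\exp\left[-\widehat{\mathrm{DSM}}_n(x_n,y_n)\right],$$ where, with $s_{p(\cdot|x)}(y)=\nabla_y\log p(y|x)$ for $p(\cdot|x)=n(\cdot;H_nx,R_n)$ and diffusion matrix $w_n(y)=k_{(B),n}(y)R_n^{1/2}$, $$\widehat{\mathrm{DSM}}_n(x,y)=\left\|w_n^T(y)s_{p(\cdot|x)}(y)\right\|_2^2+2\nabla_y\cdot\left(w_n(y)w_n^T(y)s_{p(\cdot|x)}(y)\right).$$ Regularity conditions on $\pi_n$: for every $x$, $\int\pi_n(y)\|s_{p(\cdot|x)}(y)-\nabla_y\log\pi_n(y)\|^2\,\mathrm{d}y<\infty$, and both $\pi_n w_nw_n^Ts_{p(\cdot|x)}$ and $\nabla\cdot(\pi_n w_nw_n^Ts_{p(\cdot|x)})$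 belong to $L^1(\mathbb{R}^{d_Y})$. *)

theory Defs
  imports "HOL-Probability.Probability"
begin

definition sym_posdef :: "real^'n^'n \<Rightarrow> bool" where
  "sym_posdef S \<longleftrightarrow> transpose S = S \<and> (\<forall>v. v \<noteq> 0 \<longrightarrow> v \<bullet> (S *v v) > 0)"

definition msqrt :: "real^'n^'n \<Rightarrow> real^'n^'n" where
  "msqrt S = (THE T. sym_posdef T \<and> T ** T = S)"

text \<open>This is the Gaussian density only for symmetric positive definite \<open>P\<close>; on other
  arguments the formula has no meaning.\<close>
definition gaussian_density :: "real^'n \<Rightarrow> real^'n^'n \<Rightarrow> real^'n \<Rightarrow> real" where
  "gaussian_density m P x =
     exp (- (1/2) * ((x - m) \<bullet> (matrix_inv P *v (x - m)))) / sqrt ((2 * pi) ^ CARD('n) * det P)"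

text \<open>A partition of the coordinates into blocks is given by the map \<open>blk\<close> sending each
  coordinate to the label of its block.  A subvector is padded with zeros outside its block, and a
  matrix of the size of block \<open>b\<close> is represented by a full-size matrix of which only the entries
  with both indices in block \<open>b\<close> are ever read.\<close>
definition subvec :: "('n \<Rightarrow> nat) \<Rightarrow> nat \<Rightarrow> real^'n \<Rightarrow> real^'n" where
  "subvec blk b v = (\<chi> i. if blk i = b then v $ i else 0)"

definition block_diag :: "('n \<Rightarrow> nat) \<Rightarrow> (nat \<Rightarrow> real^'n^'n) \<Rightarrow> real^'n^'n" where
  "block_diag blk M = (\<chi> i j. if blk i = blk j then M (blk i) $ i $ j else 0)"

definition partial_deriv :: "'n \<Rightarrow> (real^'n \<Rightarrow> real) \<Rightarrow> real^'n \<Rightarrow> real" where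
  "partial_deriv i f y = deriv (\<lambda>t. f (y + t *\<^sub>R axis i 1)) 0"

definition grad :: "(real^'n \<Rightarrow> real) \<Rightarrow> real^'n \<Rightarrow> real^'n" where
  "grad f y = (\<chi> i. partial_deriv i f y)"

definition divergence :: "(real^'n \<Rightarrow> real^'n) \<Rightarrow> real^'n \<Rightarrow> real" where
  "divergence F y = (\<Sum>i\<in>UNIV. partial_deriv i (\<lambda>z. F z $ i) y)"

text \<open>Row-wise divergence; for a diagonal \<open>M\<close> only the terms with \<open>j = i\<close> survive.\<close>
definition mat_divergence :: "(real^'n \<Rightarrow> real^'n^'n) \<Rightarrow> real^'n \<Rightarrow> real^'n" where
  "mat_divergence M y = (\<chi> i. \<Sum>j\<in>UNIV. partial_deriv j (\<lambda>z. M z $ i $ j) y)"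

definition score :: "(real^'n \<Rightarrow> real) \<Rightarrow> real^'n \<Rightarrow> real^'n" where
  "score p = grad (\<lambda>y. ln (p y))"

definition dsm_loss ::
    "(real^'n \<Rightarrow> real^'n^'n) \<Rightarrow> (real^'n \<Rightarrow> real) \<Rightarrow> real^'n \<Rightarrow> real" where
  "dsm_loss w p y = (norm (transpose (w y) *v score p y))\<^sup>2
     + 2 * divergence (\<lambda>z. (w z ** transpose (w z)) *v score p z) y"

definition dsm_regular ::
    "(real^'n \<Rightarrow> real) \<Rightarrow> (real^'n \<Rightarrow> real^'n^'n) \<Rightarrow> (real^'n \<Rightarrow> real) \<Rightarrow> bool" where
  "dsm_regular \<pi> w p \<longleftrightarrow>
     integrable lborel (\<lambda>y. \<pi> y * (norm (score p y - score \<pi> y))\<^sup>2) \<and>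
     integrable lborel (\<lambda>y. \<pi> y *\<^sub>R ((w y ** transpose (w y)) *v score p y)) \<and>
     integrable lborel (divergence (\<lambda>y. \<pi> y *\<^sub>R ((w y ** transpose (w y)) *v score p y)))"

definition prob_density :: "(real^'n \<Rightarrow> real) \<Rightarrow> bool" where
  "prob_density p \<longleftrightarrow> (\<forall>y. 0 \<le> p y) \<and> has_bochner_integral lborel p 1"

text \<open>The probability density proportional to \<open>f\<close>.  If \<open>f\<close> is not integrable, the integral
  below is 0 and so is the whole function.\<close>
definition normalized :: "(real^'n \<Rightarrow> real) \<Rightarrow> real^'n \<Rightarrow> real" where
  "normalized f x = f x / (\<integral>z. f z \<partial>lborel)"

text \<open>The family of independent variables consists of \<open>X 0\<close>, \<open>W n\<close> and \<open>V n\<close> for \<open>n \<ge> 1\<close>.  It is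
  expressed through the generated families of events because \<open>W n\<close> and \<open>V n\<close> have different types.\<close>
definition linear_gaussian_system ::
    "'w measure \<Rightarrow> (nat \<Rightarrow> real^'x^'x) \<Rightarrow> (nat \<Rightarrow> real^'x^'y) \<Rightarrow> (nat \<Rightarrow> real^'x^'x) \<Rightarrow> (nat \<Rightarrow> real^'y^'y) \<Rightarrow>
     real^'x \<Rightarrow> real^'x^'x \<Rightarrow>
     (nat \<Rightarrow> 'w \<Rightarrow> real^'x) \<Rightarrow> (nat \<Rightarrow> 'w \<Rightarrow> real^'y) \<Rightarrow> (nat \<Rightarrow> 'w \<Rightarrow> real^'x) \<Rightarrow> (nat \<Rightarrow> 'w \<Rightarrow> real^'y) \<Rightarrow> bool"
where
  "linear_gaussian_system \<Omega> A H Q R m0 P0 X Y W V \<longleftrightarrow>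
     prob_space \<Omega> \<and>
     distributed \<Omega> lborel (X 0) (\<lambda>x. ennreal (gaussian_density m0 P0 x)) \<and>
     (\<forall>n\<ge>1. distributed \<Omega> lborel (W n) (\<lambda>x. ennreal (gaussian_density 0 (mat 1) x))) \<and>
     (\<forall>n\<ge>1. distributed \<Omega> lborel (V n) (\<lambda>y. ennreal (gaussian_density 0 (mat 1) y))) \<and>
     prob_space.indep_sets \<Omega>
       (\<lambda>i. case i of
              Inl n \<Rightarrow> {(if n = 0 then X 0 else W n) -` S \<inter> space \<Omega> | S. S \<in> sets borel}
            | Inr n \<Rightarrow> {V n -` S \<inter> space \<Omega> | S. S \<in> sets borel})
       ((UNIV :: nat set) <+> {1::nat..}) \<and>
     (\<forall>n\<ge>1. \<forall>\<omega>\<in>space \<Omega>. X n \<omega> = A n *v X (n - 1) \<omega> + msqrt (Q n) *v W n \<omega>) \<and>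
     (\<forall>n\<ge>1. \<forall>\<omega>\<in>space \<Omega>. Y n \<omega> = H n *v X n \<omega> + msqrt (R n) *v V n \<omega>)"

end

theory Submission
  imports Defs
begin

text \<open>Since \<open>R\<close> is block diagonal and the weight \<open>k\<close> is constant on blocks, the two commute, so
  \<open>w w\<^sup>T s = - k\<^sup>2 (y - H x)\<close> and the loss is a quadratic polynomial in \<open>y - H x\<close>.  Completing the
  square gives \<open>exp (- DSM) = c n(ytilde; H x, N)\<close> with \<open>c\<close> independent of \<open>x\<close>, so that the analysis
  step is a Kalman update with pseudo-observation \<open>ytilde\<close> and covariance \<open>N\<close>.  All three integrals
  then reduce to one factorisation,
  \<open>n(z; H x, R) n(x; m, P) = n(z; H m, S) n(x; m', P')\<close>.\<close>

text \<open>A Gaussian exponent carries a factor 1/2 and the loss does not; this is the origin of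
  the 2 in \<open>N = R / (2 k\<^sup>2)\<close>. The product rule splits the divergence into a part
  linear in \<open>y - H x\<close>, weighted by the divergence of \<open>k\<^sup>2\<close>, and the
  trace of \<open>k\<^sup>2\<close>. The linear part moves the centre of the square from
  \<open>y\<close> to \<open>ytilde\<close>; the trace is free of \<open>x\<close> and disappears in
  the normalisation. The weight may depend on \<open>y\<close> nonlinearly because \<open>y\<close>
  is fixed once the derivatives are taken: only the dependence on \<open>x\<close> has to be
  Gaussian. Positive definiteness must accompany every covariance through the recursion, since
  \<open>gaussian_density\<close> is a density only then. For \<open>N\<close> and for the posterior
  covariance the formula does not show it; it comes from a congruence and from the precision matrix
  respectively. \<open>msqrt\<close> is a definite description, so existence and uniqueness of the
  root come before any use of \<open>w\<close>; the root also yields positivity of the determinant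
  and the substitution that computes the Gaussian integral.\<close>

declare transpose_matrix_vector [simp del]

section \<open>Symmetric positive definite matrices\<close>

text \<open>The adjoint rule. The simplification rule deleted above would turn
  \<open>transpose A *v y\<close> into \<open>y v* A\<close> and block its repeated use.\<close>

lemma inner_matrix_vector_mult_left:
  fixes A :: "real^'n^'m"
  shows "(A *v x) \<bullet> y = x \<bullet> (transpose A *v y)"
  by (metis dot_lmul_matrix inner_commute transpose_matrix_vector)

lemma sym_posdef_transpose: "sym_posdef S \<Longrightarrow> transpose S = S"
  by (simp add: sym_posdef_def)

lemma sym_posdef_pos: "sym_posdef S \<Longrightarrow> v \<noteq> 0 \<Longrightarrow> v \<bullet> (S *v v) > 0"
  by (simp add: sym_posdef_def)

lemma sym_posdef_nonneg: "sym_posdef S \<Longrightarrow> v \<bullet> (S *v v) \<ge> 0"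
  by (cases "v = 0") (auto simp: less_imp_le sym_posdef_pos)

lemma sym_posdef_inner: "sym_posdef S \<Longrightarrow> (S *v x) \<bullet> y = x \<bullet> (S *v y)"
  by (simp add: inner_matrix_vector_mult_left sym_posdef_transpose)

text \<open>A kernel vector \<open>v\<close> would have \<open>v \<bullet> (S *v v) = 0\<close>, so
  \<open>S\<close> is injective. As \<open>matrix_inv\<close> is a choice operator, an inverse has
  to be exhibited before anything is known about it.\<close>

lemma
  fixes S :: "real^'n^'n"
  assumes "sym_posdef S"
  shows sym_posdef_inv_right: "S ** matrix_inv S = mat 1"
    and sym_posdef_inv_left: "matrix_inv S ** S = mat 1"
proof -
  have "\<forall>x. S *v x = 0 \<longrightarrow> x = 0"
    using assms by (metis inner_zero_right less_irrefl sym_posdef_pos)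
  then obtain T where "T ** S = mat 1"
    using matrix_left_invertible_ker[of S] by auto
  then have ex: "\<exists>T. S ** T = mat 1 \<and> T ** S = mat 1"
    using matrix_left_right_inverse by blast
  show "S ** matrix_inv S = mat 1" "matrix_inv S ** S = mat 1"
    using someI_ex[OF ex] by (simp_all add: matrix_inv_def)
qed

lemma matrix_inv_eqI:
  fixes S T :: "real^'n^'n"
  assumes "S ** T = mat 1"
  shows "matrix_inv S = T"
proof -
  have TS: "T ** S = mat 1"
    using assms matrix_left_right_inverse by blast
  with assms have "S ** matrix_inv S = mat 1"
    unfolding matrix_inv_def by (metis (mono_tags, lifting) someI_ex)
  then show ?thesis
    by (metis TS matrix_mul_assoc matrix_mul_lid matrix_mul_rid)
qed

text \<open>Since \<open>v = S *v (T *v v)\<close>, the quadratic form of \<open>T\<close> at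
  \<open>v\<close> is that of \<open>S\<close> at \<open>T *v v\<close>.\<close>

lemma sym_posdef_inverseI:
  fixes S T :: "real^'n^'n"
  assumes S: "sym_posdef S" and ST: "S ** T = mat 1"
  shows "sym_posdef T"
  unfolding sym_posdef_def
proof (intro conjI allI impI)
  have TS: "T ** S = mat 1"
    using ST matrix_left_right_inverse by blast
  have "transpose T ** S = mat 1"
    using ST S by (metis matrix_transpose_mul sym_posdef_transpose transpose_mat)
  then show sym: "transpose T = T"
    by (metis ST matrix_mul_assoc matrix_mul_lid matrix_mul_rid)
  fix v :: "real^'n" assume "v \<noteq> 0"
  have v: "v = S *v (T *v v)"
    by (simp add: matrix_vector_mul_assoc ST)
  with \<open>v \<noteq> 0\<close> have "T *v v \<noteq> 0" by auto
  then have "(T *v v) \<bullet> (S *v (T *v v)) > 0"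
    by (rule sym_posdef_pos[OF S])
  then show "v \<bullet> (T *v v) > 0"
    by (metis v inner_commute)
qed

lemma sym_posdef_matrix_inv: "sym_posdef S \<Longrightarrow> sym_posdef (matrix_inv S)"
  using sym_posdef_inverseI sym_posdef_inv_right by blast

lemma transpose_add: "transpose (A + B) = transpose A + transpose (B :: real^'n^'m)"
  by (simp add: transpose_def vec_eq_iff)

text \<open>\<open>H\<close> may have any rank, so the congruence term is only semidefinite;
  strictness comes from \<open>R\<close>.\<close>

lemma sym_posdef_congruence_add:
  fixes P :: "real^'n^'n" and R :: "real^'m^'m" and H :: "real^'n^'m"
  assumes "sym_posdef P" "sym_posdef R"
  shows "sym_posdef (H ** P ** transpose H + R)"
  unfolding sym_posdef_def
proof (intro conjI allI impI)
  show "transpose (H ** P ** transpose H + R) = H ** P ** transpose H + R"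
    using assms by (simp add: transpose_add matrix_transpose_mul sym_posdef_transpose matrix_mul_assoc)
  fix v :: "real^'m" assume "v \<noteq> 0"
  have "v \<bullet> ((H ** P ** transpose H) *v v) = (transpose H *v v) \<bullet> (P *v (transpose H *v v))"
    by (simp only: matrix_vector_mul_assoc[symmetric] inner_matrix_vector_mult_left transpose_transpose)
  then have "v \<bullet> ((H ** P ** transpose H) *v v) \<ge> 0"
    using sym_posdef_nonneg[OF assms(1)] by metis
  moreover have "v \<bullet> (R *v v) > 0"
    using assms(2) \<open>v \<noteq> 0\<close> sym_posdef_pos by blast
  ultimately show "v \<bullet> ((H ** P ** transpose H + R) *v v) > 0"
    by (simp add: matrix_vector_mult_add_rdistrib inner_add_right)
qed

section \<open>Spectral theorem and square roots\<close>

text \<open>A maximiser \<open>v\<close> of the Rayleigh quotient on the unit sphere of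
  \<open>V\<close> works. The residual \<open>u = f v - l v\<close> lies in \<open>V\<close>, and
  moving from \<open>v\<close> along \<open>u\<close> would increase the quotient to first order
  unless \<open>u = 0\<close>.\<close>

lemma self_adjoint_eigenvector:
  fixes f :: "'a::euclidean_space \<Rightarrow> 'a"
  assumes f: "linear f" and sa: "\<And>x y. f x \<bullet> y = x \<bullet> f y"
    and V: "subspace V" "V \<noteq> {0}" and inv: "f ` V \<subseteq> V"
  obtains v l where "v \<in> V" "norm v = 1" "f v = l *\<^sub>R v"
proof -
  have "closed V" using V by (simp add: closed_subspace)
  then have comp: "compact (sphere 0 1 \<inter> V)" by (simp add: compact_Int_closed)
  obtain z where z: "z \<in> V" "z \<noteq> 0"
    using V subspace_0 by blast
  then have "z /\<^sub>R norm z \<in> sphere 0 1 \<inter> V"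
    using V by (simp add: subspace_scale)
  moreover have "continuous_on (sphere 0 1 \<inter> V) (\<lambda>x. x \<bullet> f x)"
    by (intro continuous_intros linear_continuous_on f linear_conv_bounded_linear[THEN iffD1])
  ultimately obtain v where v: "v \<in> sphere 0 1 \<inter> V" and max: "\<And>x. x \<in> sphere 0 1 \<inter> V \<Longrightarrow> x \<bullet> f x \<le> v \<bullet> f v"
    using continuous_attains_sup[OF comp] by (metis (no_types, lifting) empty_iff)
  define l where "l = v \<bullet> f v"
  have g: "0 \<le> l * (u \<bullet> u) - u \<bullet> f u" if "u \<in> V" for u
  proof (cases "u = 0")
    case False
    then have "u /\<^sub>R norm u \<in> sphere 0 1 \<inter> V"
      using V that by (simp add: subspace_scale)
    from max[OF this] have "(u \<bullet> f u) / (norm u)\<^sup>2 \<le> l"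
      by (simp add: linear_scale[OF f] l_def power2_eq_square divide_inverse mult_ac)
    then show ?thesis
      using False by (simp add: field_simps dot_square_norm)
  qed (simp add: linear_0[OF f])
  define u where "u = f v - l *\<^sub>R v"
  have uV: "u \<in> V"
    using v inv V by (auto simp: u_def intro!: subspace_diff subspace_scale)
  have vv: "v \<bullet> v = 1" using v by (simp add: dot_square_norm)
  define c where "c = l * (u \<bullet> u) - u \<bullet> f u"
  have c: "0 \<le> c" unfolding c_def by (rule g[OF uV])
  have poly: "0 \<le> - 2 * t * (u \<bullet> u) + t\<^sup>2 * c" for t
  proof -
    have "v + t *\<^sub>R u \<in> V" using v uV V by (simp add: subspace_add subspace_scale)
    from g[OF this] have "0 \<le> l * ((v + t *\<^sub>R u) \<bullet> (v + t *\<^sub>R u)) - (v + t *\<^sub>R u) \<bullet> f (v + t *\<^sub>R u)" .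
    also have "\<dots> = (l - v \<bullet> f v) + 2 * t * (l * (v \<bullet> u) - u \<bullet> f v) + t\<^sup>2 * c"
      using sa[of v u] by (simp add: linear_add[OF f] linear_scale[OF f] inner_add_left inner_add_right
          vv c_def power2_eq_square algebra_simps inner_commute)
    also have "l * (v \<bullet> u) - u \<bullet> f v = - (u \<bullet> u)"
      by (simp add: u_def inner_diff_right inner_diff_left inner_commute algebra_simps)
    finally show ?thesis by (simp add: l_def)
  qed
  have "u \<bullet> u = 0"
  proof (rule ccontr)
    assume "u \<bullet> u \<noteq> 0"
    then have pos: "u \<bullet> u > 0" by (simp add: less_le)
    \<comment> \<open>Small enough that the quadratic term of \<open>poly\<close> cannot compensate
      the linear one; the summand 1 covers \<open>c = 0\<close>.\<close>
    define t where "t = (u \<bullet> u) / (c + 1)"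
    have t: "t > 0" using pos c by (simp add: t_def)
    have "t * c < 2 * (u \<bullet> u)"
      using pos c by (simp add: t_def field_simps add_nonneg_pos)
    then have "t * (t * c) < t * (2 * (u \<bullet> u))" using t by simp
    then show False using poly[of t] by (simp add: power2_eq_square algebra_simps)
  qed
  then have "f v = l *\<^sub>R v" by (simp add: u_def)
  with v show ?thesis by (intro that) auto
qed

text \<open>Stated for invariant subspaces so that induction on the dimension applies: by
  self-adjointness the orthogonal complement in \<open>V\<close> of an eigenvector is again
  invariant.\<close>

lemma self_adjoint_eigenbasis:
  fixes f :: "'a::euclidean_space \<Rightarrow> 'a"
  assumes f: "linear f" and sa: "\<And>x y. f x \<bullet> y = x \<bullet> f y"
  shows "subspace V \<Longrightarrow> f ` V \<subseteq> V \<Longrightarrow>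
    \<exists>B. finite B \<and> B \<subseteq> V \<and> pairwise orthogonal B \<and> (\<forall>b\<in>B. norm b = 1) \<and> V \<subseteq> span B \<and> (\<forall>b\<in>B. \<exists>l. f b = l *\<^sub>R b)"
proof (induction "dim V" arbitrary: V rule: less_induct)
  case less
  show ?case
  proof (cases "V = {0}")
    case True
    then show ?thesis by (intro exI[of _ "{}"]) auto
  next
    case False
    obtain v l where v: "v \<in> V" "norm v = 1" "f v = l *\<^sub>R v"
      using self_adjoint_eigenvector[OF f sa less.prems(1) False less.prems(2)] by blast
    define W where "W = V \<inter> {x. v \<bullet> x = 0}"
    have W: "subspace W"
      unfolding W_def by (intro subspace_inter less.prems subspace_hyperplane)
    have WV: "W \<subset> V"
    proof
      have "v \<notin> W" using v by (simp add: W_def dot_square_norm)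
      then show "W \<noteq> V" using v by blast
    qed (simp add: W_def)
    have dimW: "dim W < dim V"
      by (metis WV W less.prems(1) dim_psubset span_eq_iff)
    have "f x \<in> W" if "x \<in> W" for x
      using that less.prems(2) sa[of v x] v by (auto simp: W_def)
    then obtain B where B: "finite B" "B \<subseteq> W" "pairwise orthogonal B" "\<forall>b\<in>B. norm b = 1"
        "W \<subseteq> span B" "\<forall>b\<in>B. \<exists>l. f b = l *\<^sub>R b"
      using less.hyps[OF dimW W] by blast
    have "x \<in> span (insert v B)" if "x \<in> V" for x
    proof -
      have "x - (v \<bullet> x) *\<^sub>R v \<in> W"
        using that v less.prems(1) by (auto simp: W_def subspace_diff subspace_scale inner_diff_right dot_square_norm)
      then show ?thesis using B(5) by (auto simp: span_insert)
    qed
    moreover have "pairwise orthogonal (insert v B)"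
      using B(2,3) by (auto simp: pairwise_insert W_def orthogonal_def inner_commute)
    ultimately show ?thesis
      using B v WV by (intro exI[of _ "insert v B"]) auto
  qed
qed

corollary self_adjoint_orthonormal_eigenbasis:
  fixes f :: "'a::euclidean_space \<Rightarrow> 'a"
  assumes "linear f" "\<And>x y. f x \<bullet> y = x \<bullet> f y"
  obtains B where "finite B" "pairwise orthogonal B" "\<And>b. b \<in> B \<Longrightarrow> norm b = 1" "span B = UNIV"
    "\<And>b. b \<in> B \<Longrightarrow> \<exists>l. f b = l *\<^sub>R b"
proof -
  obtain B where "finite B" "pairwise orthogonal B" "\<forall>b\<in>B. norm b = 1" "UNIV \<subseteq> span B"
      "\<forall>b\<in>B. \<exists>l. f b = l *\<^sub>R b"
    using self_adjoint_eigenbasis[OF assms subspace_UNIV] by blast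
  then show ?thesis by (intro that[of B]) auto
qed

text \<open>The root acts on an orthonormal eigenbasis of \<open>S\<close> by the square roots of
  the eigenvalues, which are positive.\<close>

lemma sym_posdef_sqrt_ex:
  fixes S :: "real^'n^'n"
  assumes S: "sym_posdef S"
  obtains T where "sym_posdef T" "T ** T = S"
proof -
  obtain B where B: "finite B" "pairwise orthogonal B" "\<And>b. b \<in> B \<Longrightarrow> norm b = 1" "span B = UNIV"
      "\<And>b. b \<in> B \<Longrightarrow> \<exists>l. S *v b = l *\<^sub>R b"
    using self_adjoint_orthonormal_eigenbasis[OF matrix_vector_mul_linear sym_posdef_inner[OF S]] by blast
  define l where "l b = b \<bullet> (S *v b)" for b
  have l: "S *v b = l b *\<^sub>R b" if "b \<in> B" for b
    using B(3,5)[OF that] by (auto simp: l_def dot_square_norm)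
  have lpos: "l b > 0" if "b \<in> B" for b
    using B(3)[OF that] sym_posdef_pos[OF S, of b] by (force simp: l_def)
  have expand: "(\<Sum>b\<in>B. (x \<bullet> b) *\<^sub>R b) = x" for x
    using orthonormal_basis_expand[OF B(2,3) _ B(1)] B(4) by auto
  define f where "f x = (\<Sum>b\<in>B. (sqrt (l b) * (x \<bullet> b)) *\<^sub>R b)" for x
  have lin: "linear f"
    unfolding f_def by (rule linearI) (simp_all add: inner_add_left algebra_simps sum.distrib scaleR_sum_right)
  define T where "T = matrix f"
  have T: "T *v x = f x" for x
    by (metis T_def lin matrix_vector_mul(2))
  have ortho: "b \<bullet> b' = (if b = b' then 1 else 0)" if "b \<in> B" "b' \<in> B" for b b'
    using B(2,3) that by (auto simp: pairwise_def orthogonal_def dot_square_norm)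
  have fb: "f b = sqrt (l b) *\<^sub>R b" if "b \<in> B" for b
    unfolding f_def using that B(1) by (simp add: ortho if_distrib if_distribR cong: if_cong sum.cong)
  have inn: "x \<bullet> f y = (\<Sum>b\<in>B. sqrt (l b) * (x \<bullet> b) * (y \<bullet> b))" for x y
    by (simp add: f_def inner_sum_right mult_ac)
  have "T ** T = S"
    unfolding matrix_eq
  proof
    fix x
    have "f (f x) = (\<Sum>b\<in>B. (sqrt (l b) * (x \<bullet> b)) *\<^sub>R f b)"
      by (subst (2) f_def) (simp add: linear_sum[OF lin] linear_scale[OF lin])
    also have "\<dots> = (\<Sum>b\<in>B. (x \<bullet> b) *\<^sub>R (S *v b))"
      using lpos by (intro sum.cong) (auto simp: fb l less_imp_le)
    also have "\<dots> = S *v (\<Sum>b\<in>B. (x \<bullet> b) *\<^sub>R b)"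
      by (simp add: linear_sum[OF matrix_vector_mul_linear] matrix_vector_mult_scaleR)
    finally show "(T ** T) *v x = S *v x"
      by (simp add: matrix_vector_mul_assoc[symmetric] T expand)
  qed
  moreover have "sym_posdef T"
    unfolding sym_posdef_def
  proof (intro conjI allI impI)
    have "x \<bullet> (transpose T *v y) = x \<bullet> (T *v y)" for x y
      by (simp add: inner_matrix_vector_mult_left[symmetric] T inn)
         (simp add: inner_commute[of "f x"] inn mult_ac)
    then show "transpose T = T"
      unfolding matrix_eq by (metis vector_eq_ldot)
    fix v :: "real^'n" assume "v \<noteq> 0"
    then obtain b where b: "b \<in> B" "v \<bullet> b \<noteq> 0"
      using expand[of v] by (metis (no_types, lifting) scale_zero_left sum.neutral)
    have "0 < (\<Sum>b\<in>B. sqrt (l b) * (v \<bullet> b)\<^sup>2)"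
      using b lpos by (intro sum_pos2[OF B(1) b(1)]) (auto simp: less_imp_le)
    then show "v \<bullet> (T *v v) > 0"
      by (simp add: T inn power2_eq_square mult_ac)
  qed
  ultimately show ?thesis using that by blast
qed

text \<open>With \<open>D = S - T\<close> one has
  \<open>S D + D T = S\<^sup>2 - T\<^sup>2 = 0\<close>. Tested on a unit eigenvector
  \<open>b\<close> of \<open>D\<close>, this reads
  \<open>l (b \<bullet> S b + b \<bullet> T b) = 0\<close> and forces the eigenvalue
  \<open>l\<close> to vanish. No common eigenbasis of \<open>S\<close> and \<open>T\<close> is
  required.\<close>

lemma sym_posdef_sqrt_unique:
  fixes S T :: "real^'n^'n"
  assumes S: "sym_posdef S" and T: "sym_posdef T" and eq: "S ** S = T ** T"
  shows "S = T"
proof -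
  define D where "D = S - T"
  have sa: "(D *v x) \<bullet> y = x \<bullet> (D *v y)" for x y
    by (simp add: D_def matrix_vector_mult_diff_rdistrib inner_diff_left inner_diff_right
        sym_posdef_inner[OF S] sym_posdef_inner[OF T])
  obtain B where "finite B" "pairwise orthogonal B" and B: "\<And>b. b \<in> B \<Longrightarrow> norm b = 1" "span B = UNIV"
      "\<And>b. b \<in> B \<Longrightarrow> \<exists>l. D *v b = l *\<^sub>R b"
    using self_adjoint_orthonormal_eigenbasis[OF matrix_vector_mul_linear[of D] sa] by blast
  have "D *v b = 0" if b: "b \<in> B" for b
  proof -
    obtain l where l: "D *v b = l *\<^sub>R b" using B(3)[OF b] by blast
    have "S *v (D *v b) + D *v (T *v b) = 0"
      using arg_cong[OF eq, of "\<lambda>M. M *v b"]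
      by (simp add: D_def matrix_vector_mult_diff_rdistrib matrix_vector_mult_diff_distrib
          matrix_vector_mul_assoc[symmetric])
    then have "b \<bullet> (S *v (D *v b)) + b \<bullet> (D *v (T *v b)) = 0"
      by (metis inner_add_right inner_zero_right)
    then have "l * (b \<bullet> (S *v b) + b \<bullet> (T *v b)) = 0"
      by (simp add: sa[symmetric] l matrix_vector_mult_scaleR algebra_simps)
    moreover have "b \<noteq> 0" using B(1)[OF b] by auto
    ultimately have "l = 0"
      using sym_posdef_pos[OF S, of b] sym_posdef_pos[OF T, of b] by simp
    then show ?thesis by (simp add: l)
  qed
  then have "D *v x = 0" for x
    using linear_eq_0_on_span[OF matrix_vector_mul_linear, of B D x] B(2) by auto
  then have "S *v x = T *v x" for x
    by (simp add: D_def matrix_vector_mult_diff_rdistrib)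
  then show ?thesis by (simp add: matrix_eq)
qed

lemma
  assumes "sym_posdef S"
  shows sym_posdef_msqrt: "sym_posdef (msqrt S)" and msqrt_square: "msqrt S ** msqrt S = S"
proof -
  have "\<exists>!T. sym_posdef T \<and> T ** T = S"
    using sym_posdef_sqrt_ex[OF assms] sym_posdef_sqrt_unique by metis
  from theI'[OF this] show "sym_posdef (msqrt S)" "msqrt S ** msqrt S = S"
    by (simp_all add: msqrt_def)
qed

text \<open>The determinant is nonzero by invertibility and is the square of the determinant of the
  root.\<close>

lemma sym_posdef_det_pos:
  fixes S :: "real^'n^'n"
  assumes "sym_posdef S"
  shows "det S > 0"
proof -
  have "det S * det (matrix_inv S) = 1"
    using sym_posdef_inv_right[OF assms] by (metis det_I det_mul)
  then have "det S \<noteq> 0" by auto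
  moreover have "det S = (det (msqrt S))\<^sup>2"
    by (metis msqrt_square[OF assms] det_mul power2_eq_square)
  ultimately show ?thesis
    by (metis zero_less_power2 power_zero_numeral)
qed

section \<open>Lebesgue measure under linear maps\<close>

lemma nn_integral_lborel_translate:
  fixes g :: "'a::euclidean_space \<Rightarrow> ennreal"
  assumes [measurable]: "g \<in> borel_measurable borel"
  shows "(\<integral>\<^sup>+x. g (x + c) \<partial>lborel) = (\<integral>\<^sup>+x. g x \<partial>lborel)"
proof -
  have "(\<integral>\<^sup>+x. g x \<partial>lborel) = (\<integral>\<^sup>+x. g x \<partial>distr lborel borel ((+) c))"
    by (simp add: lborel_distr_plus)
  also have "\<dots> = (\<integral>\<^sup>+x. g (c + x) \<partial>lborel)"
    by (rule nn_integral_distr) simp_all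
  finally show ?thesis by (simp add: add.commute)
qed

text \<open>Averaging over translations along the direction of a shear turns the shear into a
  translation of the averaging variable.\<close>
lemma nn_integral_lborel_shear:
  fixes g :: "'a::euclidean_space \<Rightarrow> ennreal"
  assumes [measurable]: "g \<in> borel_measurable borel" and ab: "a \<bullet> b = 0"
  shows "(\<integral>\<^sup>+x. g (x + (a \<bullet> x) *\<^sub>R b) \<partial>lborel) = (\<integral>\<^sup>+x. g x \<partial>lborel)"
proof -
  define \<phi> :: "real \<Rightarrow> ennreal" where "\<phi> = indicator {0..1}"
  have [measurable]: "\<phi> \<in> borel_measurable borel" by (simp add: \<phi>_def)
  have \<phi>: "(\<integral>\<^sup>+t. \<phi> (t + c) \<partial>lborel) = 1" for c
    by (simp add: nn_integral_lborel_translate) (simp add: \<phi>_def)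
  let ?I = "\<integral>\<^sup>+x. g (x + (a \<bullet> x) *\<^sub>R b) \<partial>lborel"
  \<comment> \<open>Here orthogonality enters: translating \<open>x\<close> along \<open>b\<close>
    leaves \<open>a \<bullet> x\<close> unchanged.\<close>
  have tr: "(\<integral>\<^sup>+x. g (x + (t + a \<bullet> x) *\<^sub>R b) \<partial>lborel) = ?I" for t
    using nn_integral_lborel_translate[of "\<lambda>x. g (x + (a \<bullet> x) *\<^sub>R b)" "t *\<^sub>R b"]
    by (simp add: inner_add_right ab algebra_simps)
  have "?I = (\<integral>\<^sup>+t. \<phi> t \<partial>lborel) * ?I"
    using \<phi>[of 0] by simp
  also have "\<dots> = (\<integral>\<^sup>+t. \<phi> t * (\<integral>\<^sup>+x. g (x + (t + a \<bullet> x) *\<^sub>R b) \<partial>lborel) \<partial>lborel)"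
    by (simp add: tr nn_integral_multc)
  also have "\<dots> = (\<integral>\<^sup>+t. (\<integral>\<^sup>+x. \<phi> t * g (x + (t + a \<bullet> x) *\<^sub>R b) \<partial>lborel) \<partial>lborel)"
    by (simp add: nn_integral_cmult)
  also have "\<dots> = (\<integral>\<^sup>+x. (\<integral>\<^sup>+t. \<phi> t * g (x + (t + a \<bullet> x) *\<^sub>R b) \<partial>lborel) \<partial>lborel)"
    by (rule lborel_pair.Fubini') simp
  also have "\<dots> = (\<integral>\<^sup>+x. (\<integral>\<^sup>+t. \<phi> (t - a \<bullet> x) * g (x + t *\<^sub>R b) \<partial>lborel) \<partial>lborel)"
  proof (rule nn_integral_cong)
    fix x
    show "(\<integral>\<^sup>+t. \<phi> t * g (x + (t + a \<bullet> x) *\<^sub>R b) \<partial>lborel) = (\<integral>\<^sup>+t. \<phi> (t - a \<bullet> x) * g (x + t *\<^sub>R b) \<partial>lborel)"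
      using nn_integral_lborel_translate[of "\<lambda>t. \<phi> (t - a \<bullet> x) * g (x + t *\<^sub>R b)" "a \<bullet> x"] by simp
  qed
  also have "\<dots> = (\<integral>\<^sup>+t. (\<integral>\<^sup>+x. \<phi> (t - a \<bullet> x) * g (x + t *\<^sub>R b) \<partial>lborel) \<partial>lborel)"
    by (rule lborel_pair.Fubini') simp
  also have "\<dots> = (\<integral>\<^sup>+t. (\<integral>\<^sup>+x. \<phi> (t - a \<bullet> x) * g x \<partial>lborel) \<partial>lborel)"
  proof (rule nn_integral_cong)
    fix t
    show "(\<integral>\<^sup>+x. \<phi> (t - a \<bullet> x) * g (x + t *\<^sub>R b) \<partial>lborel) = (\<integral>\<^sup>+x. \<phi> (t - a \<bullet> x) * g x \<partial>lborel)"
      using nn_integral_lborel_translate[of "\<lambda>x. \<phi> (t - a \<bullet> x) * g x" "t *\<^sub>R b"]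
      by (simp add: inner_add_right ab)
  qed
  also have "\<dots> = (\<integral>\<^sup>+x. (\<integral>\<^sup>+t. \<phi> (t - a \<bullet> x) * g x \<partial>lborel) \<partial>lborel)"
    by (rule lborel_pair.Fubini') simp
  also have "\<dots> = (\<integral>\<^sup>+x. g x \<partial>lborel)"
  proof (rule nn_integral_cong)
    fix x
    have "(\<integral>\<^sup>+t. \<phi> (t - a \<bullet> x) \<partial>lborel) = 1"
      using \<phi>[of "- (a \<bullet> x)"] by simp
    then show "(\<integral>\<^sup>+t. \<phi> (t - a \<bullet> x) * g x \<partial>lborel) = g x"
      by (simp add: nn_integral_multc)
  qed
  finally show ?thesis .
qed

text \<open>Lebesgue measure is determined by its values on boxes, and permuting coordinates only
  reorders the side lengths of a box.\<close>

lemma nn_integral_lborel_permute: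
  fixes g :: "real^'n \<Rightarrow> ennreal"
  assumes [measurable]: "g \<in> borel_measurable borel" and p: "p permutes UNIV"
  shows "(\<integral>\<^sup>+x. g (\<chi> i. x $ p i) \<partial>lborel) = (\<integral>\<^sup>+x. g x \<partial>lborel)"
proof -
  define f :: "real^'n \<Rightarrow> real^'n" where "f x = (\<chi> i. x $ p i)" for x
  have "linear f"
    by (rule linearI) (simp_all add: f_def vec_eq_iff)
  then have [measurable]: "f \<in> borel_measurable borel"
    by (intro borel_measurable_continuous_onI linear_continuous_on linear_conv_bounded_linear[THEN iffD1])
  let ?q = "inv p"
  have pq: "p (?q i) = i" "?q (p i) = i" for i
    using permutes_inverses[OF p] by auto
  have "lborel = distr lborel borel f"
  proof (rule lborel_eqI)
    fix l u :: "real^'n" assume le: "\<And>b. b \<in> Basis \<Longrightarrow> l \<bullet> b \<le> u \<bullet> b"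
    have le': "l $ i \<le> u $ i" for i
      using le[of "axis i 1"] by (simp add: inner_axis)
    have "f -` box l u = box (\<chi> i. l $ ?q i) (\<chi> i. u $ ?q i)"
      by (auto simp: f_def mem_box_cart) (metis pq)+
    then have "emeasure (distr lborel borel f) (box l u) = emeasure lborel (box (\<chi> i. l $ ?q i) (\<chi> i. u $ ?q i))"
      by (simp add: emeasure_distr)
    also have "\<dots> = ennreal (\<Prod>b\<in>Basis. ((\<chi> i. u $ ?q i) - (\<chi> i. l $ ?q i)) \<bullet> b)"
      using le' by (intro emeasure_lborel_box) (auto simp: Basis_vec_def inner_axis)
    also have "(\<Prod>b\<in>Basis. ((\<chi> i. u $ ?q i) - (\<chi> i. l $ ?q i)) \<bullet> b) = (\<Prod>i\<in>UNIV. u $ ?q i - l $ ?q i)"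
      by (simp add: Basis_vec_def inner_axis prod.UNION_disjoint axis_eq_axis image_UN)
    also have "\<dots> = (\<Prod>i\<in>UNIV. u $ i - l $ i)"
      by (rule prod.permute[OF permutes_inv[OF p], symmetric, unfolded o_def])
    also have "\<dots> = (\<Prod>b\<in>Basis. (u - l) \<bullet> b)"
      by (simp add: Basis_vec_def inner_axis prod.UNION_disjoint axis_eq_axis image_UN)
    finally show "emeasure (distr lborel borel f) (box l u) = (\<Prod>b\<in>Basis. (u - l) \<bullet> b)" .
  qed simp
  then have "(\<integral>\<^sup>+x. g x \<partial>lborel) = (\<integral>\<^sup>+x. g x \<partial>distr lborel borel f)"
    by simp
  also have "\<dots> = (\<integral>\<^sup>+x. g (f x) \<partial>lborel)"
    by (rule nn_integral_distr) simp_all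
  finally show ?thesis by (simp add: f_def)
qed

lemma nn_integral_lborel_stretch:
  fixes g :: "real^'n \<Rightarrow> ennreal"
  assumes [measurable]: "g \<in> borel_measurable borel" and c: "\<And>i. c i \<noteq> 0"
  shows "(\<integral>\<^sup>+x. g x \<partial>lborel) = ennreal \<bar>\<Prod>i\<in>UNIV. c i\<bar> * (\<integral>\<^sup>+x. g (\<chi> i. c i * x $ i) \<partial>lborel)"
proof -
  \<comment> \<open>\<open>lborel_affine_euclidean\<close> takes its scaling factors along the
    vectors of \<open>Basis\<close>, so \<open>c\<close> is transported there.\<close>
  define d where "d b = c (axis_index b)" for b :: "real^'n"
  have sumB: "(\<Sum>j\<in>Basis. (d j * (x \<bullet> j)) *\<^sub>R j) = (\<chi> i. c i * x $ i)" for x :: "real^'n"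
  proof -
    have "(\<Sum>j\<in>Basis. (d j * (x \<bullet> j)) *\<^sub>R j) = (\<Sum>i\<in>UNIV. (c i * x $ i) *\<^sub>R axis i 1)"
      by (simp add: Basis_vec_def d_def sum.UNION_disjoint axis_eq_axis image_UN inner_axis axis_index_axis)
    also have "\<dots> = (\<chi> i. c i * x $ i)"
      by (simp add: vec_eq_iff axis_def if_distrib cong: if_cong)
    finally show ?thesis .
  qed
  have prodB: "(\<Prod>j\<in>Basis. \<bar>d j\<bar>) = \<bar>\<Prod>i\<in>UNIV. c i\<bar>"
    by (simp add: Basis_vec_def d_def prod.UNION_disjoint axis_eq_axis image_UN abs_prod axis_index_axis)
  have eq: "lborel = density (distr lborel borel (\<lambda>x. \<chi> i. c i * x $ i)) (\<lambda>_. ennreal \<bar>\<Prod>i\<in>UNIV. c i\<bar>)"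
    using lborel_affine_euclidean[of d 0] c unfolding sumB prodB by (simp add: d_def)
  have lin: "linear (\<lambda>x::real^'n. \<chi> i. c i * x $ i)"
    by (rule linearI) (simp_all add: vec_eq_iff algebra_simps)
  then have [measurable]: "(\<lambda>x::real^'n. \<chi> i. c i * x $ i) \<in> borel_measurable borel"
    by (intro borel_measurable_continuous_onI linear_continuous_on linear_conv_bounded_linear[THEN iffD1])
  show ?thesis
    by (subst eq) (simp add: nn_integral_density nn_integral_distr nn_integral_cmult)
qed

text \<open>The linear change of variables in HOL-Analysis is restricted to well-ordered index types.\<close>
lemma nn_integral_lborel_linear:
  fixes f :: "real^'n \<Rightarrow> real^'n"
  assumes "linear f" "det (matrix f) \<noteq> 0" "g \<in> borel_measurable borel"
  shows "(\<integral>\<^sup>+x. g x \<partial>lborel) = ennreal \<bar>det (matrix f)\<bar> * (\<integral>\<^sup>+x. g (f x) \<partial>lborel)"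
proof -
  \<comment> \<open>Quantifying over \<open>g\<close> is essential for compositions, where the
    property of \<open>h\<close> is applied to \<open>g\<close> after \<open>f\<close>. The premise
    on the determinant makes the singular elementary maps harmless.\<close>
  let ?P = "\<lambda>f. det (matrix f) \<noteq> 0 \<longrightarrow> (\<forall>g \<in> borel_measurable borel.
    (\<integral>\<^sup>+x. g x \<partial>lborel) = ennreal \<bar>det (matrix f)\<bar> * (\<integral>\<^sup>+x. g (f x) \<partial>lborel))"
  have "?P f"
  proof (rule induct_linear_elementary[OF assms(1)])
    fix f h :: "real^'n \<Rightarrow> real^'n" assume f: "linear f" and h: "linear h" and P: "?P f" "?P h"
    have det: "det (matrix (f \<circ> h)) = det (matrix f) * det (matrix h)"
      by (simp add: matrix_compose[OF h f] det_mul)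
    show "?P (f \<circ> h)"
    proof (intro impI ballI)
      fix g :: "real^'n \<Rightarrow> ennreal" assume nz: "det (matrix (f \<circ> h)) \<noteq> 0" and g: "g \<in> borel_measurable borel"
      have "f \<in> borel_measurable borel"
        using f by (intro borel_measurable_continuous_onI linear_continuous_on linear_conv_bounded_linear[THEN iffD1])
      then have gf: "(\<lambda>x. g (f x)) \<in> borel_measurable borel" using g by measurable
      have "(\<integral>\<^sup>+x. g x \<partial>lborel) = ennreal \<bar>det (matrix f)\<bar> * (\<integral>\<^sup>+x. g (f x) \<partial>lborel)"
        using P(1) nz g det by auto
      also have "(\<integral>\<^sup>+x. g (f x) \<partial>lborel) = ennreal \<bar>det (matrix h)\<bar> * (\<integral>\<^sup>+x. g (f (h x)) \<partial>lborel)"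
        using P(2) nz gf det by auto
      finally show "(\<integral>\<^sup>+x. g x \<partial>lborel) = ennreal \<bar>det (matrix (f \<circ> h))\<bar> * (\<integral>\<^sup>+x. g ((f \<circ> h) x) \<partial>lborel)"
        by (simp add: det abs_mult ennreal_mult mult.assoc)
    qed
  next
    fix f :: "real^'n \<Rightarrow> real^'n" and i assume "linear f" "\<And>x. f x $ i = 0"
    then have "det (matrix f) = 0"
      by (intro det_zero_row(2)[of i]) (simp add: row_def matrix_def vec_eq_iff)
    then show "?P f" by simp
  next
    fix c :: "'n \<Rightarrow> real"
    have "det (matrix (\<lambda>x::real^'n. \<chi> i. c i * x $ i)) = (\<Prod>i\<in>UNIV. c i)"
      by (subst det_diagonal) (simp_all add: matrix_def axis_def)
    then show "?P (\<lambda>x. \<chi> i. c i * x $ i)"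
      using nn_integral_lborel_stretch[of _ c] by (auto simp: prod_zero_iff)
  next
    fix m n :: 'n assume "m \<noteq> n"
    let ?p = "Transposition.transpose m n"
    have p: "?p permutes UNIV" by (simp add: permutes_swap_id)
    have "matrix (\<lambda>x::real^'n. \<chi> i. x $ ?p i) = (\<chi> i. (mat 1 :: real^'n^'n) $ ?p i)"
      by (simp add: matrix_def mat_def axis_def vec_eq_iff)
    then have "\<bar>det (matrix (\<lambda>x::real^'n. \<chi> i. x $ ?p i))\<bar> = 1"
      using det_permute_rows[OF p, of "mat 1 :: real^'n^'n"] by (simp add: sign_def)
    then show "?P (\<lambda>x. \<chi> i. x $ ?p i)"
      using nn_integral_lborel_permute[OF _ p] by auto
  next
    fix m n :: 'n assume mn: "m \<noteq> n"
    \<comment> \<open>Adding coordinate \<open>n\<close> to coordinate \<open>m\<close> is a shear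
      along \<open>axis m 1\<close>, which is orthogonal to \<open>axis n 1\<close> because
      \<open>m \<noteq> n\<close>.\<close>
    have eq: "(\<chi> i. if i = m then x $ m + x $ n else x $ i) = x + (axis n 1 \<bullet> x) *\<^sub>R axis m 1" for x :: "real^'n"
      by (simp add: vec_eq_iff inner_axis') (simp add: axis_def)
    have "matrix (\<lambda>x::real^'n. \<chi> i. if i = m then x $ m + x $ n else x $ i)
        = (\<chi> k. if k = m then row m (mat 1) + 1 *s row n (mat 1) else row k (mat 1))"
      using mn by (simp add: matrix_def mat_def axis_def vec_eq_iff row_def)
    then have "det (matrix (\<lambda>x::real^'n. \<chi> i. if i = m then x $ m + x $ n else x $ i)) = 1"
      using det_row_operation[OF mn, of "mat 1 :: real^'n^'n" 1] by simp
    moreover have "axis n 1 \<bullet> (axis m 1 :: real^'n) = 0"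
      using mn by (simp add: inner_axis_axis)
    ultimately show "?P (\<lambda>x. \<chi> i. if i = m then x $ m + x $ n else x $ i)"
      unfolding eq by (auto intro!: nn_integral_lborel_shear[symmetric])
  qed
  then show ?thesis using assms by blast
qed

section \<open>Gaussian densities\<close>

lemma measurable_matrix_vector_mult [measurable (raw)]:
  fixes A :: "real^'n^'m"
  assumes "f \<in> borel_measurable M"
  shows "(\<lambda>x. A *v f x) \<in> borel_measurable M"
proof -
  have "(*v) A \<in> borel_measurable borel"
    by (intro borel_measurable_continuous_onI linear_continuous_on linear_conv_bounded_linear[THEN iffD1]
        matrix_vector_mul_linear)
  then show ?thesis using assms by measurable
qed

lemma measurable_gaussian_density [measurable (raw)]:
  assumes [measurable]: "f \<in> borel_measurable M" "g \<in> borel_measurable M"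
  shows "(\<lambda>x. gaussian_density (f x) P (g x)) \<in> borel_measurable M"
  unfolding gaussian_density_def by measurable

lemma gaussian_density_const_pos:
  fixes P :: "real^'n^'n"
  shows "sym_posdef P \<Longrightarrow> 0 < sqrt ((2 * pi) ^ CARD('n) * det P)"
  by (simp add: sym_posdef_det_pos)

lemma gaussian_density_pos: "sym_posdef P \<Longrightarrow> 0 < gaussian_density m P x"
  using gaussian_density_const_pos[of P] by (simp add: gaussian_density_def)

lemma gaussian_density_shift: "gaussian_density m P x = gaussian_density 0 P (x - m)"
  by (simp add: gaussian_density_def)

text \<open>The substitution \<open>x = T u\<close> with the root \<open>T\<close> of
  \<open>P\<close> whitens the density: the factor \<open>det T\<close> cancels the square root of
  \<open>det P\<close>, and a product of standard normal densities remains.\<close>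

lemma nn_integral_gaussian_density:
  fixes P :: "real^'n^'n"
  assumes P: "sym_posdef P"
  shows "(\<integral>\<^sup>+x. ennreal (gaussian_density m P x) \<partial>lborel) = 1"
proof -
  define T where "T = msqrt P"
  have T: "sym_posdef T" and TT: "T ** T = P"
    using P by (simp_all add: T_def sym_posdef_msqrt msqrt_square)
  have dT: "det T > 0" using T by (rule sym_posdef_det_pos)
  have std: "gaussian_density 0 P (T *v u) * det T = (\<Prod>b\<in>Basis. std_normal_density (u \<bullet> b))" for u
  proof -
    \<comment> \<open>Bracketed so that \<open>T ** matrix_inv P\<close> is a right inverse of
      \<open>T\<close>, hence also a left inverse.\<close>
    have "T ** (T ** matrix_inv P) = mat 1"
      using sym_posdef_inv_right[OF P] by (simp add: matrix_mul_assoc TT)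
    then have "(T ** matrix_inv P) ** T = mat 1"
      using matrix_left_right_inverse by blast
    then have "(T *v u) \<bullet> (matrix_inv P *v (T *v u)) = u \<bullet> u"
      by (simp add: sym_posdef_inner[OF T] matrix_vector_mul_assoc matrix_mul_assoc)
    moreover have "sqrt ((2 * pi) ^ CARD('n) * det P) = sqrt (2 * pi) ^ CARD('n) * det T"
      using dT by (simp add: TT[symmetric] det_mul real_sqrt_mult real_sqrt_power power_mult_distrib)
    ultimately have "gaussian_density 0 P (T *v u) * det T = exp (- (u \<bullet> u) / 2) / sqrt (2 * pi) ^ CARD('n)"
      using dT by (simp add: gaussian_density_def)
    also have "u \<bullet> u = (\<Sum>b\<in>Basis. (u \<bullet> b)\<^sup>2)"
      by (subst euclidean_inner) (simp add: power2_eq_square)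
    also have "exp (- (\<Sum>b\<in>Basis. (u \<bullet> b)\<^sup>2) / 2) / sqrt (2 * pi) ^ CARD('n)
        = (\<Prod>b\<in>Basis. std_normal_density (u \<bullet> b))"
      by (simp add: std_normal_density_def prod.distrib power_one_over exp_sum sum_negf[symmetric]
          sum_divide_distrib prod_dividef)
    finally show ?thesis .
  qed
  have one: "(\<integral>\<^sup>+x. ennreal (std_normal_density x) \<partial>lborel) = 1"
    using prob_space.emeasure_space_1[OF prob_space_normal_density[of 1 0]]
    by (simp add: emeasure_density)
  have "(\<integral>\<^sup>+x. ennreal (gaussian_density m P x) \<partial>lborel) = (\<integral>\<^sup>+x. ennreal (gaussian_density 0 P x) \<partial>lborel)"
    using nn_integral_lborel_translate[of "\<lambda>x. ennreal (gaussian_density 0 P x)" "- m"]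
    by (simp add: gaussian_density_shift[of m])
  also have "\<dots> = ennreal (det T) * (\<integral>\<^sup>+x. ennreal (gaussian_density 0 P (T *v x)) \<partial>lborel)"
    using nn_integral_lborel_linear[of "(*v) T" "\<lambda>x. ennreal (gaussian_density 0 P x)"] dT by simp
  also have "\<dots> = (\<integral>\<^sup>+x. ennreal (gaussian_density 0 P (T *v x) * det T) \<partial>lborel)"
    using dT gaussian_density_pos[OF P]
    by (simp add: nn_integral_cmult[symmetric] ennreal_mult[symmetric] less_imp_le mult.commute)
  also have "\<dots> = (\<integral>\<^sup>+x. (\<Prod>b\<in>Basis. ennreal (std_normal_density (x \<bullet> b))) \<partial>(lborel :: (real^'n) measure))"
    by (simp add: std prod_ennreal)
  also have "\<dots> = 1"
    by (subst nn_integral_lborel_prod) (simp_all add: one)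
  finally show ?thesis .
qed

lemma has_bochner_integral_gaussian_density:
  assumes "sym_posdef P"
  shows "has_bochner_integral lborel (gaussian_density m P) 1"
  using nn_integral_gaussian_density[OF assms, of m] gaussian_density_pos[OF assms]
  by (intro has_bochner_integral_nn_integral) (auto simp: less_imp_le)

section \<open>Products of Gaussian densities\<close>

text \<open>Prior covariance \<open>P\<close>, noise covariance \<open>R\<close>, observation matrix
  \<open>H\<close>. One time step uses three instances: the forecast (\<open>A n\<close> in the role
  of \<open>H\<close>, \<open>Q n\<close> as noise), the density of the observation
  (\<open>R n\<close> as noise) and the analysis (\<open>NB n (y n)\<close> as noise).\<close>

locale gaussian_update =
  fixes P :: "real^'n^'n" and R :: "real^'m^'m" and H :: "real^'n^'m"
  assumes P: "sym_posdef P" and R: "sym_posdef R"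
begin

text \<open>In Kalman filter terms: innovation covariance \<open>S\<close>, gain \<open>K\<close>,
  posterior covariance \<open>P'\<close> and posterior precision \<open>J\<close>.\<close>

definition "S = H ** P ** transpose H + R"
definition "K = P ** transpose H ** matrix_inv S"
definition "P' = P - K ** H ** P"
definition "J = transpose H ** matrix_inv R ** H + matrix_inv P"

lemma sym_posdef_S: "sym_posdef S"
  unfolding S_def by (intro sym_posdef_congruence_add P R)

lemma sym_posdef_J: "sym_posdef J"
  unfolding J_def using sym_posdef_congruence_add[OF sym_posdef_matrix_inv[OF R] sym_posdef_matrix_inv[OF P], of "transpose H"]
  by simp

lemma inv_cancel [simp]:
  "matrix_inv P *v (P *v x) = x" "matrix_inv R *v (R *v y) = y" "R *v (matrix_inv R *v y) = y"
  by (simp_all add: matrix_vector_mul_assoc sym_posdef_inv_left[OF P] sym_posdef_inv_left[OF R] sym_posdef_inv_right[OF R])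

text \<open>This is \<open>H P H\<^sup>T = S - R\<close> multiplied by the inverse of
  \<open>S\<close>. In right-nested form on vectors it serves as a rewrite rule, after which
  \<open>inv_cancel\<close> removes \<open>R\<close>.\<close>

lemma HPH_inv_S: "H *v (P *v (transpose H *v (matrix_inv S *v v))) = v - R *v (matrix_inv S *v v)"
proof -
  have "S *v (matrix_inv S *v v) = v"
    by (simp add: matrix_vector_mul_assoc sym_posdef_inv_right[OF sym_posdef_S])
  then show ?thesis
    by (subst (asm) (1) S_def) (simp add: matrix_vector_mult_add_rdistrib matrix_vector_mul_assoc[symmetric] algebra_simps)
qed

text \<open>The Woodbury identity. Through it \<open>P'\<close> inherits positive definiteness from
  \<open>J\<close>, where it is evident as a sum; the difference defining \<open>P'\<close> hides
  it.\<close>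

lemma J_mult_P': "J ** P' = mat 1"
  unfolding matrix_eq
proof
  fix x
  show "(J ** P') *v x = mat 1 *v x"
    by (simp add: J_def P'_def K_def matrix_vector_mul_assoc[symmetric] matrix_vector_mult_add_rdistrib
        matrix_vector_mult_diff_rdistrib matrix_vector_mult_diff_distrib HPH_inv_S)
qed

lemma sym_posdef_P': "sym_posdef P'"
  by (rule sym_posdef_inverseI[OF sym_posdef_J J_mult_P'])

lemma inv_P': "matrix_inv P' = J"
  using J_mult_P' by (intro matrix_inv_eqI) (simp add: matrix_left_right_inverse)

text \<open>The information form of the gain, \<open>K = P' H\<^sup>T R\<^sup>-\<^sup>1\<close>,
  which identifies the centre of the square below.\<close>

lemma J_mult_K: "J *v (K *v v) = transpose H *v (matrix_inv R *v v)"
  by (simp add: J_def K_def matrix_vector_mul_assoc[symmetric] matrix_vector_mult_add_rdistrib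
      matrix_vector_mult_diff_rdistrib matrix_vector_mult_diff_distrib HPH_inv_S)

text \<open>Completing the square in \<open>u\<close>: the quadratic part is \<open>J\<close>, and
  by \<open>J_mult_K\<close> the linear part is \<open>J *v (K *v v)\<close>, so the centre is
  \<open>K *v v\<close>. What remains in \<open>v\<close> collapses to the form of the inverse of
  \<open>S\<close> by \<open>HPH_inv_S\<close>.\<close>

lemma exponent:
  "(v - H *v u) \<bullet> (matrix_inv R *v (v - H *v u)) + u \<bullet> (matrix_inv P *v u)
    = v \<bullet> (matrix_inv S *v v) + (u - K *v v) \<bullet> (matrix_inv P' *v (u - K *v v))"
proof -
  have HK: "H *v (K *v v) = v - R *v (matrix_inv S *v v)"
    by (simp add: K_def matrix_vector_mul_assoc[symmetric] HPH_inv_S)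
  have "(v - H *v u) \<bullet> (matrix_inv R *v (v - H *v u)) + u \<bullet> (matrix_inv P *v u)
      = v \<bullet> (matrix_inv R *v v) - 2 * ((H *v u) \<bullet> (matrix_inv R *v v)) + u \<bullet> (J *v u)"
    using sym_posdef_inner[OF sym_posdef_matrix_inv[OF R], of v "H *v u"]
    by (simp add: J_def matrix_vector_mult_diff_distrib matrix_vector_mult_add_rdistrib inner_diff_left inner_diff_right
        inner_add_right matrix_vector_mul_assoc[symmetric] inner_matrix_vector_mult_left inner_commute)
  moreover have "(u - K *v v) \<bullet> (J *v (u - K *v v))
      = u \<bullet> (J *v u) - 2 * (u \<bullet> (J *v (K *v v))) + (K *v v) \<bullet> (J *v (K *v v))"
    using sym_posdef_inner[OF sym_posdef_J, of u "K *v v"]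
    by (simp add: matrix_vector_mult_diff_distrib inner_diff_left inner_diff_right inner_commute)
  moreover have "(K *v v) \<bullet> (J *v (K *v v)) = v \<bullet> (matrix_inv R *v v) - v \<bullet> (matrix_inv S *v v)"
  proof -
    have "(K *v v) \<bullet> (J *v (K *v v)) = (H *v (K *v v)) \<bullet> (matrix_inv R *v v)"
      by (simp add: J_mult_K inner_matrix_vector_mult_left)
    also have "\<dots> = v \<bullet> (matrix_inv R *v v) - v \<bullet> (matrix_inv S *v v)"
      by (simp add: HK inner_diff_left sym_posdef_inner[OF R]) (simp add: inner_commute)
    finally show ?thesis .
  qed
  moreover have "u \<bullet> (J *v (K *v v)) = (H *v u) \<bullet> (matrix_inv R *v v)"
    by (simp add: J_mult_K inner_matrix_vector_mult_left)
  ultimately show ?thesis by (simp add: inv_P')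
qed

text \<open>Both sides integrate to 1 over \<open>(x, z)\<close>, so the normalising constants need not be compared:
  no determinant identity between \<open>S\<close>, \<open>R\<close>, \<open>P\<close> and \<open>P'\<close> is used.\<close>
lemma gaussian_density_mult:
  "gaussian_density (H *v x) R z * gaussian_density m P x
    = gaussian_density (H *v m) S z * gaussian_density (m - K *v (H *v m - z)) P' x"
proof -
  let ?C = "\<lambda>d n. sqrt ((2 * pi) ^ n * d)"
  define c where "c = (?C (det S) CARD('m) * ?C (det P') CARD('n)) / (?C (det R) CARD('m) * ?C (det P) CARD('n))"
  note pos = gaussian_density_const_pos[OF P] gaussian_density_const_pos[OF R]
    gaussian_density_const_pos[OF sym_posdef_S] gaussian_density_const_pos[OF sym_posdef_P']
  have c0: "c > 0" unfolding c_def using pos by (intro divide_pos_pos mult_pos_pos)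
  have eq: "gaussian_density (H *v x) R z * gaussian_density m P x
    = c * (gaussian_density (H *v m) S z * gaussian_density (m - K *v (H *v m - z)) P' x)" for x z
  proof -
    have "exp (- (1/2) * ((z - H *v x) \<bullet> (matrix_inv R *v (z - H *v x)))) * exp (- (1/2) * ((x - m) \<bullet> (matrix_inv P *v (x - m))))
      = exp (- (1/2) * ((z - H *v m) \<bullet> (matrix_inv S *v (z - H *v m)))) *
        exp (- (1/2) * ((x - (m - K *v (H *v m - z))) \<bullet> (matrix_inv P' *v (x - (m - K *v (H *v m - z))))))"
      using exponent[of "z - H *v m" "x - m"]
      by (simp add: exp_add[symmetric] matrix_vector_mult_diff_distrib algebra_simps)
    then show ?thesis
      unfolding gaussian_density_def c_def using pos[THEN less_imp_neq] by (simp add: divide_simps)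
  qed
  have "ennreal c = (\<integral>\<^sup>+z. ennreal (c * gaussian_density (H *v m) S z) \<partial>lborel)"
    using c0 gaussian_density_pos[OF sym_posdef_S]
    by (simp add: ennreal_mult less_imp_le nn_integral_cmult nn_integral_gaussian_density[OF sym_posdef_S])
  also have "\<dots> = (\<integral>\<^sup>+z. (\<integral>\<^sup>+x. ennreal (c * gaussian_density (H *v m) S z) *
      ennreal (gaussian_density (m - K *v (H *v m - z)) P' x) \<partial>lborel) \<partial>lborel)"
    by (simp add: nn_integral_cmult nn_integral_gaussian_density[OF sym_posdef_P'])
  also have "\<dots> = (\<integral>\<^sup>+z. (\<integral>\<^sup>+x. ennreal (gaussian_density (H *v x) R z * gaussian_density m P x) \<partial>lborel) \<partial>lborel)"
    using c0 gaussian_density_pos[OF sym_posdef_S] gaussian_density_pos[OF sym_posdef_P']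
    by (simp add: eq ennreal_mult less_imp_le mult.assoc)
  also have "\<dots> = (\<integral>\<^sup>+x. (\<integral>\<^sup>+z. ennreal (gaussian_density (H *v x) R z * gaussian_density m P x) \<partial>lborel) \<partial>lborel)"
    by (rule lborel_pair.Fubini') simp
  also have "\<dots> = (\<integral>\<^sup>+x. ennreal (gaussian_density m P x) \<partial>lborel)"
    using gaussian_density_pos[OF R] gaussian_density_pos[OF P]
    by (simp add: ennreal_mult less_imp_le nn_integral_multc nn_integral_gaussian_density[OF R])
  also have "\<dots> = 1"
    by (rule nn_integral_gaussian_density[OF P])
  finally have "c = 1" by simp
  with eq show ?thesis by simp
qed

lemma integral_gaussian_density_mult:
  "(\<integral>x. gaussian_density (H *v x) R z * gaussian_density m P x \<partial>lborel) = gaussian_density (H *v m) S z"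
  using has_bochner_integral_integral_eq[OF has_bochner_integral_gaussian_density[OF sym_posdef_P']]
  by (simp add: gaussian_density_mult)

text \<open>Every factor free of \<open>x\<close> cancels, so a likelihood is needed only up to a
  nonzero constant; the other cancelled factor, the density at \<open>z\<close>, is
  positive.\<close>

lemma normalized_gaussian_density_mult:
  assumes "c \<noteq> 0"
  shows "normalized (\<lambda>x. c * (gaussian_density (H *v x) R z * gaussian_density m P x)) x
    = gaussian_density (m - K *v (H *v m - z)) P' x"
  using assms gaussian_density_pos[OF sym_posdef_S, of "H *v m" z]
  by (simp add: normalized_def integral_gaussian_density_mult) (simp add: gaussian_density_mult)

end

section \<open>The diffusion score matching loss\<close>

lemma partial_deriv_eqI:
  "((\<lambda>t. f (y + t *\<^sub>R axis i 1)) has_real_derivative d) (at 0) \<Longrightarrow> partial_deriv i f y = d"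
  unfolding partial_deriv_def by (rule DERIV_imp_deriv)

text \<open>Along a coordinate axis the log-density is a quadratic polynomial in \<open>t\<close>;
  symmetry of the precision matrix merges its two cross terms and cancels the factor 1/2.\<close>

lemma score_gaussian_density:
  fixes R :: "real^'m^'m"
  assumes R: "sym_posdef R"
  shows "score (gaussian_density m R) z = - (matrix_inv R *v (z - m))"
proof -
  let ?M = "matrix_inv R"
  have M: "sym_posdef ?M" by (rule sym_posdef_matrix_inv[OF R])
  define C where "C = sqrt ((2 * pi) ^ CARD('m) * det R)"
  have C: "C > 0" unfolding C_def by (rule gaussian_density_const_pos[OF R])
  have "partial_deriv i (\<lambda>y. ln (gaussian_density m R y)) z = - ((?M *v (z - m)) $ i)" for i
  proof (rule partial_deriv_eqI)
    let ?e = "axis i 1 :: real^'m"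
    have quad: "(u + t *\<^sub>R ?e) \<bullet> (?M *v (u + t *\<^sub>R ?e))
        = u \<bullet> (?M *v u) + 2 * t * (?e \<bullet> (?M *v u)) + t\<^sup>2 * (?e \<bullet> (?M *v ?e))" for u t
      using sym_posdef_inner[OF M, of u ?e]
      by (simp add: matrix_vector_right_distrib matrix_vector_mult_scaleR power2_eq_square inner_commute algebra_simps)
    have "ln (gaussian_density m R (z + t *\<^sub>R ?e))
      = - (1/2) * ((z - m) \<bullet> (?M *v (z - m)) + 2 * t * ((?M *v (z - m)) $ i) + t\<^sup>2 * (?e \<bullet> (?M *v ?e))) - ln C" for t
    proof -
      have "ln (gaussian_density m R (z + t *\<^sub>R ?e))
          = - (1/2) * ((z + t *\<^sub>R ?e - m) \<bullet> (?M *v (z + t *\<^sub>R ?e - m))) - ln C"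
        unfolding gaussian_density_def C_def[symmetric] using C by (simp add: ln_div)
      also have "z + t *\<^sub>R ?e - m = (z - m) + t *\<^sub>R ?e" by simp
      also note quad
      finally show ?thesis by (simp add: inner_axis')
    qed
    then show "((\<lambda>t. ln (gaussian_density m R (z + t *\<^sub>R ?e))) has_real_derivative - ((?M *v (z - m)) $ i)) (at 0)"
      by (auto intro!: derivative_eq_intros)
  qed
  then show ?thesis
    by (simp add: score_def grad_def vec_eq_iff)
qed

lemma sym_posdef_congruence:
  fixes E R :: "real^'m^'m"
  assumes R: "sym_posdef R" and E: "\<And>v. transpose E *v v = 0 \<Longrightarrow> v = 0"
  shows "sym_posdef (E ** R ** transpose E)"
  unfolding sym_posdef_def
proof (intro conjI allI impI)
  show "transpose (E ** R ** transpose E) = E ** R ** transpose E"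
    using R by (simp add: matrix_transpose_mul sym_posdef_transpose matrix_mul_assoc)
  fix v :: "real^'m" assume "v \<noteq> 0"
  then have "0 < (transpose E *v v) \<bullet> (R *v (transpose E *v v))"
    using E by (intro sym_posdef_pos[OF R]) auto
  then show "0 < v \<bullet> ((E ** R ** transpose E) *v v)"
    by (simp only: matrix_vector_mul_assoc[symmetric] inner_matrix_vector_mult_left transpose_transpose)
qed

section \<open>Diagonal matrices\<close>

definition diagonal :: "('m \<Rightarrow> real) \<Rightarrow> real^'m^'m" where
  "diagonal c = (\<chi> i j. if i = j then c i else 0)"

lemma diagonal_mult_vec: "(diagonal c *v v) $ i = c i * v $ i"
  by (simp add: diagonal_def matrix_vector_mult_def if_distrib[of "\<lambda>a. a * _"] cong: if_cong)

lemma diagonal_mult_matrix: "(diagonal c ** M) $ i $ j = c i * M $ i $ j"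
  by (simp add: diagonal_def matrix_matrix_mult_def if_distrib[of "\<lambda>a. a * _"] cong: if_cong)

lemma matrix_mult_diagonal: "(M ** diagonal c) $ i $ j = M $ i $ j * c j"
  by (simp add: diagonal_def matrix_matrix_mult_def if_distrib cong: if_cong)

lemma transpose_diagonal: "transpose (diagonal c) = diagonal c"
  by (simp add: diagonal_def transpose_def vec_eq_iff)

lemma diagonal_mult_diagonal: "diagonal c ** diagonal d = diagonal (\<lambda>i. c i * d i)"
  by (simp add: vec_eq_iff diagonal_mult_matrix) (simp add: diagonal_def)

text \<open>Blocks are replaced by one weight per coordinate: \<open>commute\<close> says that
  \<open>R\<close> couples only coordinates of equal weight. Differentiability is asked of each
  squared weight along its own axis at \<open>y\<close>, because only diagonal entries enter the
  divergence.\<close>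

locale diagonal_diffusion =
  fixes R :: "real^'m^'m" and \<kappa> :: "'m \<Rightarrow> real^'m \<Rightarrow> real" and y :: "real^'m"
  assumes R: "sym_posdef R"
    and \<kappa>_pos: "\<And>i z. \<kappa> i z > 0"
    and commute: "\<And>i j z. \<kappa> i z * R $ i $ j = R $ i $ j * \<kappa> j z"
    and differentiable: "\<And>i. \<exists>d. ((\<lambda>t. (\<kappa> i (y + t *\<^sub>R axis i 1))\<^sup>2) has_real_derivative d) (at 0)"
begin

definition D where "D z = diagonal (\<lambda>i. \<kappa> i z)"
definition w where "w z = D z ** msqrt R"
text \<open>A row scaling of \<open>R\<close>, namely half of \<open>R\<close> multiplied on the
  left by the inverse of \<open>D y ** D y\<close>; \<open>commute\<close> makes it
  symmetric.\<close>

definition N where "N = (\<chi> i j. R $ i $ j / (2 * (\<kappa> i y)\<^sup>2))"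
definition d where "d = mat_divergence (\<lambda>z. D z ** D z) y"

lemma D_commute_R: "D z ** R = R ** D z"
  by (simp add: vec_eq_iff D_def diagonal_mult_matrix matrix_mult_diagonal commute)

text \<open>\<open>partial_deriv\<close> is a total operator, so its value is a genuine derivative
  only by \<open>differentiable\<close>. The off-diagonal terms of the row-wise divergence
  vanish.\<close>

lemma has_derivative_\<kappa>: "((\<lambda>t. (\<kappa> i (y + t *\<^sub>R axis i 1))\<^sup>2) has_real_derivative d $ i) (at 0)"
proof -
  have "(\<Sum>j\<in>UNIV. partial_deriv j (\<lambda>z. (D z ** D z) $ i $ j) y)
      = (\<Sum>j\<in>UNIV. if i = j then partial_deriv i (\<lambda>z. (\<kappa> i z)\<^sup>2) y else 0)"
    by (rule sum.cong)
       (auto simp: D_def diagonal_mult_diagonal partial_deriv_def, auto simp: diagonal_def power2_eq_square)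
  then have "d $ i = partial_deriv i (\<lambda>z. (\<kappa> i z)\<^sup>2) y"
    by (simp add: d_def mat_divergence_def)
  moreover obtain d' where "((\<lambda>t. (\<kappa> i (y + t *\<^sub>R axis i 1))\<^sup>2) has_real_derivative d') (at 0)"
    using differentiable by blast
  ultimately show ?thesis
    using partial_deriv_eqI[of "\<lambda>z. (\<kappa> i z)\<^sup>2" y i d'] by simp
qed

text \<open>\<open>w w\<^sup>T = D R D = D\<^sup>2 R\<close>, and \<open>R\<close> cancels against
  the precision in the score. The two roots meet before anything is commuted, so \<open>D\<close>
  has to commute with \<open>R\<close> only.\<close>

lemma weighted_score:
  "(w z ** transpose (w z)) *v score (gaussian_density m R) z = - (D z *v (D z *v (z - m)))"
proof -
  have "w z ** transpose (w z) = D z ** (msqrt R ** msqrt R) ** D z"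
    using sym_posdef_transpose[OF sym_posdef_msqrt[OF R]]
    by (simp add: w_def matrix_transpose_mul D_def transpose_diagonal matrix_mul_assoc)
  also have "\<dots> = D z ** D z ** R"
    using D_commute_R[of z] by (metis msqrt_square[OF R] matrix_mul_assoc)
  finally have "(w z ** transpose (w z)) *v score (gaussian_density m R) z
      = - (D z *v (D z *v ((R ** matrix_inv R) *v (z - m))))"
    by (simp add: score_gaussian_density[OF R] matrix_vector_mul_assoc[symmetric] vec.neg)
  then show ?thesis
    by (simp add: sym_posdef_inv_right[OF R])
qed

lemma norm_score:
  "(norm (transpose (w z) *v score (gaussian_density m R) z))\<^sup>2
    = (z - m) \<bullet> (matrix_inv R *v (D z *v (D z *v (z - m))))"
proof -
  let ?s = "score (gaussian_density m R) z"
  have "(norm (transpose (w z) *v ?s))\<^sup>2 = ?s \<bullet> ((w z ** transpose (w z)) *v ?s)"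
    by (simp add: dot_square_norm[symmetric] inner_matrix_vector_mult_left matrix_vector_mul_assoc[symmetric])
  also have "\<dots> = (matrix_inv R *v (z - m)) \<bullet> (D z *v (D z *v (z - m)))"
    by (simp add: weighted_score) (simp add: score_gaussian_density[OF R])
  finally show ?thesis
    by (simp add: sym_posdef_inner[OF sym_posdef_matrix_inv[OF R]])
qed

text \<open>Product rule for \<open>- (\<kappa> i z)\<^sup>2 (z $ i - m $ i)\<close>. The term that
  differentiates the second factor is free of \<open>m\<close>.\<close>

lemma divergence_weighted_score:
  "divergence (\<lambda>z. (w z ** transpose (w z)) *v score (gaussian_density m R) z) y
    = - (d \<bullet> (y - m)) - (\<Sum>i\<in>UNIV. (\<kappa> i y)\<^sup>2)"
proof -
  have "partial_deriv i (\<lambda>z. ((w z ** transpose (w z)) *v score (gaussian_density m R) z) $ i) y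
      = - (d $ i * (y - m) $ i) - (\<kappa> i y)\<^sup>2" for i
  proof (rule partial_deriv_eqI)
    have "((\<lambda>t. - ((\<kappa> i (y + t *\<^sub>R axis i 1))\<^sup>2 * (y $ i + t - m $ i))) has_real_derivative
        - (d $ i * (y - m) $ i) - (\<kappa> i y)\<^sup>2) (at 0)"
      by (rule derivative_eq_intros has_derivative_\<kappa> refl)+ simp
    then show "((\<lambda>t. ((w (y + t *\<^sub>R axis i 1) ** transpose (w (y + t *\<^sub>R axis i 1)))
        *v score (gaussian_density m R) (y + t *\<^sub>R axis i 1)) $ i) has_real_derivative
        - (d $ i * (y - m) $ i) - (\<kappa> i y)\<^sup>2) (at 0)"
      by (simp add: weighted_score D_def diagonal_mult_vec power2_eq_square mult.assoc)
  qed
  then show ?thesis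
    by (simp add: divergence_def inner_vec_def sum_subtractf sum_negf)
qed

text \<open>The row scaling is split evenly between rows and columns, making \<open>N\<close> a
  congruence of \<open>R\<close>. This is legitimate because a nonzero entry of \<open>R\<close>
  forces its row and column weights to agree.\<close>

lemma sym_posdef_N: "sym_posdef N"
proof -
  define E :: "real^'m^'m" where "E = diagonal (\<lambda>i. 1 / (sqrt 2 * \<kappa> i y))"
  have "v = 0" if "transpose E *v v = 0" for v
  proof -
    have "(E *v v) $ i = 0" for i using that by (simp add: E_def transpose_diagonal)
    then show ?thesis using \<kappa>_pos by (auto simp: vec_eq_iff E_def diagonal_mult_vec less_imp_neq[symmetric])
  qed
  then have "sym_posdef (E ** R ** transpose E)"
    by (rule sym_posdef_congruence[OF R])
  moreover have "E ** R ** transpose E = N"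
  proof -
    have "R $ i $ j / (\<kappa> i y * \<kappa> j y) = R $ i $ j / (\<kappa> i y)\<^sup>2" for i j
      using commute[of i y j] \<kappa>_pos[of i y] \<kappa>_pos[of j y] by (cases "R $ i $ j = 0") (auto simp: power2_eq_square)
    then show ?thesis
      by (simp add: vec_eq_iff E_def N_def transpose_diagonal matrix_mult_diagonal diagonal_mult_matrix)
         (simp add: field_simps)
  qed
  ultimately show ?thesis by simp
qed

text \<open>Read off from \<open>2 D D N = R\<close>, so that \<open>D\<close> never has to be
  inverted.\<close>

lemma inv_N: "matrix_inv N *v v = 2 *\<^sub>R (matrix_inv R *v (D y *v (D y *v v)))"
proof -
  have "2 *\<^sub>R (D y ** D y ** N) = R"
    using \<kappa>_pos less_imp_neq[OF \<kappa>_pos]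
    by (simp add: vec_eq_iff D_def diagonal_mult_diagonal diagonal_mult_matrix N_def power2_eq_square)
  then have "2 *\<^sub>R (D y *v (D y *v (N *v x))) = R *v x" for x
    by (metis matrix_vector_mul_assoc scaleR_matrix_vector_assoc)
  moreover have "N *v (matrix_inv N *v v) = v"
    by (simp add: matrix_vector_mul_assoc sym_posdef_inv_right[OF sym_posdef_N])
  ultimately have "2 *\<^sub>R (D y *v (D y *v v)) = R *v (matrix_inv N *v v)"
    by metis
  then have "matrix_inv R *v (2 *\<^sub>R (D y *v (D y *v v))) = (matrix_inv R ** R) *v (matrix_inv N *v v)"
    by (simp add: matrix_vector_mul_assoc[symmetric])
  then show ?thesis
    by (simp add: sym_posdef_inv_left[OF R] matrix_vector_mult_scaleR)
qed

text \<open>Completing the square in \<open>m\<close>.\<close>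
lemma exp_dsm_loss:
  obtains c where "c > 0"
    "\<And>m. exp (- dsm_loss w (gaussian_density m R) y) = c * gaussian_density m N (y - 2 *\<^sub>R (N *v d))"
proof -
  let ?C = "sqrt ((2 * pi) ^ CARD('m) * det N)"
  \<comment> \<open>All terms of the exponent free of \<open>m\<close>: the trace part of the
    divergence and the correction left by completing the square.\<close>
  define a where "a = 2 * (\<Sum>i\<in>UNIV. (\<kappa> i y)\<^sup>2) + 2 * (d \<bullet> (N *v d))"
  have "exp (- dsm_loss w (gaussian_density m R) y) = (exp a * ?C) * gaussian_density m N (y - 2 *\<^sub>R (N *v d))" for m
  proof -
    let ?u = "y - m"
    have loss: "dsm_loss w (gaussian_density m R) y
        = (1/2) * (?u \<bullet> (matrix_inv N *v ?u)) - 2 * (d \<bullet> ?u) - 2 * (\<Sum>i\<in>UNIV. (\<kappa> i y)\<^sup>2)"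
      by (simp add: dsm_loss_def norm_score divergence_weighted_score inv_N algebra_simps
          del: inner_diff_left inner_diff_right matrix_vector_mult_diff_distrib)
    have "matrix_inv N *v (N *v d) = d"
      by (simp add: matrix_vector_mul_assoc sym_posdef_inv_left[OF sym_posdef_N])
    moreover have "(N *v d) \<bullet> (matrix_inv N *v ?u) = d \<bullet> ?u"
      using calculation sym_posdef_inner[OF sym_posdef_matrix_inv[OF sym_posdef_N]] by metis
    ultimately have "(?u - 2 *\<^sub>R (N *v d)) \<bullet> (matrix_inv N *v (?u - 2 *\<^sub>R (N *v d)))
        = ?u \<bullet> (matrix_inv N *v ?u) - 4 * (d \<bullet> ?u) + 4 * (d \<bullet> (N *v d))"
      by (simp only: matrix_vector_mult_diff_distrib[of _ ?u] matrix_vector_mult_scaleR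
          inner_diff_left[of ?u] inner_diff_right[of _ "matrix_inv N *v ?u"] inner_scaleR_left inner_scaleR_right)
         (simp add: inner_commute)
    moreover have "y - 2 *\<^sub>R (N *v d) - m = ?u - 2 *\<^sub>R (N *v d)"
      by simp
    ultimately have "- dsm_loss w (gaussian_density m R) y
        = a + - (1/2) * ((y - 2 *\<^sub>R (N *v d) - m) \<bullet> (matrix_inv N *v (y - 2 *\<^sub>R (N *v d) - m)))"
      unfolding loss a_def by (simp only:) (simp add: algebra_simps del: inner_diff_left inner_diff_right matrix_vector_mult_diff_distrib)
    then show ?thesis
      using gaussian_density_const_pos[OF sym_posdef_N, THEN less_imp_neq]
      by (simp only: exp_add gaussian_density_def[of m N]) simp
  qed
  moreover have "exp a * ?C > 0"
    using gaussian_density_const_pos[OF sym_posdef_N] by simp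
  ultimately show ?thesis using that by blast
qed

end

section \<open>Block diagonal robust weights\<close>

lemma block_diag_scaled_identity:
  "block_diag blk (\<lambda>b. c b *\<^sub>R mat 1) = diagonal (\<lambda>i. c (blk i))"
  by (auto simp: vec_eq_iff block_diag_def diagonal_def mat_def)

lemma linear_subvec: "linear (subvec blk b)"
  by (rule linearI) (simp_all add: subvec_def vec_eq_iff)

text \<open>Squaring removes the root: along a line the squared weight is the reciprocal of a
  positive quadratic polynomial in \<open>t\<close>. Existence suffices, as \<open>ytilde\<close> is
  expressed through the divergence itself.\<close>

lemma has_derivative_robust_weight:
  fixes M :: "real^'m^'m"
  shows "\<exists>d. ((\<lambda>t. ((1 + (norm (subvec blk b (M *v (y + t *\<^sub>R e - m))))\<^sup>2 / q\<^sup>2) powr (- 1 / 2))\<^sup>2)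
    has_real_derivative d) (at 0)"
proof -
  let ?L = "\<lambda>v. subvec blk b (M *v v)"
  let ?u = "?L (y - m)" and ?v = "?L e"
  have lin: "linear ?L"
    using linear_compose[OF matrix_vector_mul_linear linear_subvec] by (simp add: o_def)
  have "?L (y + t *\<^sub>R e - m) = ?u + t *\<^sub>R ?v" for t
    using linear_add[OF lin, of "y - m" "t *\<^sub>R e"] linear_scale[OF lin, of t e] by (simp add: algebra_simps)
  then have norm: "(norm (?L (y + t *\<^sub>R e - m)))\<^sup>2 = ?u \<bullet> ?u + 2 * t * (?u \<bullet> ?v) + t\<^sup>2 * (?v \<bullet> ?v)" for t
    by (simp only: dot_square_norm[symmetric])
       (simp add: inner_add_left inner_add_right inner_commute power2_eq_square algebra_simps)
  let ?f = "\<lambda>t. 1 + (norm (?L (y + t *\<^sub>R e - m)))\<^sup>2 / q\<^sup>2"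
  have pos: "?f t > 0" for t
    by (intro add_pos_nonneg) simp_all
  have "((?f t) powr (- 1 / 2))\<^sup>2 = 1 / ?f t" for t
    using pos[of t] by (subst powr_power) (simp_all add: powr_minus_divide)
  moreover have "((\<lambda>t. 1 / (1 + (a + 2 * t * b + t\<^sup>2 * c) * r)) has_real_derivative - (2 * b * r) / (1 + a * r)\<^sup>2) (at 0)"
    if "1 + a * r > 0" for a b c r :: real
    using that by (auto intro!: derivative_eq_intros simp: power2_eq_square)
  then have "\<exists>d. ((\<lambda>t. 1 / ?f t) has_real_derivative d) (at 0)"
    using pos[of 0] unfolding norm divide_inverse[of _ "q\<^sup>2"] by (intro exI) force
  ultimately show ?thesis by simp
qed

section \<open>The filtering recursion, by induction on time\<close>

theorem corollary4:
  fixes \<Omega> :: "'w measure"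
    and X W :: "nat \<Rightarrow> 'w \<Rightarrow> real^'x"
    and Y V :: "nat \<Rightarrow> 'w \<Rightarrow> real^'y"
    and A Q :: "nat \<Rightarrow> real^'x^'x"
    and H :: "nat \<Rightarrow> real^'x^'y"
    and R :: "nat \<Rightarrow> real^'y^'y"
    and m0 :: "real^'x" and P0 :: "real^'x^'x"
    and B :: nat and blk :: "'y \<Rightarrow> nat"
    and Rb :: "nat \<Rightarrow> nat \<Rightarrow> real^'y^'y"
    and q :: "nat \<Rightarrow> real"
    and y :: "nat \<Rightarrow> real^'y"
    and \<pi> :: "nat \<Rightarrow> real^'y \<Rightarrow> real"
    and mf ma :: "nat \<Rightarrow> real^'x" and Pf Pa :: "nat \<Rightarrow> real^'x^'x"
    and \<Sigma> :: "nat \<Rightarrow> real^'y^'y"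
    and k :: "nat \<Rightarrow> nat \<Rightarrow> real^'y \<Rightarrow> real"
    and N :: "nat \<Rightarrow> nat \<Rightarrow> real^'y \<Rightarrow> real^'y^'y"
    and kB NB w :: "nat \<Rightarrow> real^'y \<Rightarrow> real^'y^'y"
    and ytilde :: "nat \<Rightarrow> real^'y"
    and K :: "nat \<Rightarrow> real^'y^'x"
    and p_forecast p_dsm :: "nat \<Rightarrow> real^'x \<Rightarrow> real"
    and p_obs :: "nat \<Rightarrow> real^'y \<Rightarrow> real"
  assumes system: "linear_gaussian_system \<Omega> A H Q R m0 P0 X Y W V"
    and P0: "sym_posdef P0"
    and Q: "\<And>n. n \<ge> 1 \<Longrightarrow> sym_posdef (Q n)"
    and R: "\<And>n. n \<ge> 1 \<Longrightarrow> sym_posdef (R n)"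
    and B: "B \<in> {1..CARD('y)}"
    and blocks: "range blk = {1..B}"
    and R_block: "\<And>n. n \<ge> 1 \<Longrightarrow> R n = block_diag blk (Rb n)"
    and q: "\<And>b. b \<in> {1..B} \<Longrightarrow> (q b)\<^sup>2 > 0"
    \<comment> \<open>parameter recursion\<close>
    and ma_0: "ma 0 = m0"
    and Pa_0: "Pa 0 = P0"
    and Pf: "\<And>n. n \<ge> 1 \<Longrightarrow> Pf n = A n ** Pa (n - 1) ** transpose (A n) + Q n"
    and mf: "\<And>n. n \<ge> 1 \<Longrightarrow> mf n = A n *v ma (n - 1)"
    and \<Sigma>: "\<And>n. n \<ge> 1 \<Longrightarrow> \<Sigma> n = H n ** Pf n ** transpose (H n) + R n"
    and k: "\<And>n b z. n \<ge> 1 \<Longrightarrow> b \<in> {1..B} \<Longrightarrow>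
      k n b z = (1 + (norm (subvec blk b (msqrt (matrix_inv (\<Sigma> n)) *v (z - H n *v mf n))))\<^sup>2 / (q b)\<^sup>2)
                  powr (- 1 / 2)"
    and N: "\<And>n b z. n \<ge> 1 \<Longrightarrow> b \<in> {1..B} \<Longrightarrow> N n b z = (1 / (2 * (k n b z)\<^sup>2)) *\<^sub>R Rb n b"
    and kB: "\<And>n z. n \<ge> 1 \<Longrightarrow> kB n z = block_diag blk (\<lambda>b. k n b z *\<^sub>R mat 1)"
    and NB: "\<And>n z. n \<ge> 1 \<Longrightarrow> NB n z = block_diag blk (\<lambda>b. N n b z)"
    and ytilde: "\<And>n. n \<ge> 1 \<Longrightarrow>
      ytilde n = y n - 2 *\<^sub>R (NB n (y n) *v mat_divergence (\<lambda>z. kB n z ** kB n z) (y n))"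
    and K: "\<And>n. n \<ge> 1 \<Longrightarrow>
      K n = Pf n ** transpose (H n) ** matrix_inv (NB n (y n) + H n ** Pf n ** transpose (H n))"
    and Pa: "\<And>n. n \<ge> 1 \<Longrightarrow> Pa n = Pf n - K n ** H n ** Pf n"
    and ma: "\<And>n. n \<ge> 1 \<Longrightarrow> ma n = mf n - K n *v (H n *v mf n - ytilde n)"
    \<comment> \<open>diffusion matrix and regularity of the data generating densities\<close>
    and w: "\<And>n z. n \<ge> 1 \<Longrightarrow> w n z = kB n z ** msqrt (R n)"
    and pi_density: "\<And>n. n \<ge> 1 \<Longrightarrow> prob_density (\<pi> n)"
    and pi_regular: "\<And>n x. n \<ge> 1 \<Longrightarrow>
      dsm_regular (\<pi> n) (w n) (gaussian_density (H n *v x) (R n))"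
    \<comment> \<open>diffusion score matching filtering equations\<close>
    and p_dsm_0: "\<And>x. p_dsm 0 x = gaussian_density m0 P0 x"
    and p_forecast: "\<And>n x. n \<ge> 1 \<Longrightarrow>
      p_forecast n x = (\<integral>x'. gaussian_density (A n *v x') (Q n) x * p_dsm (n - 1) x' \<partial>lborel)"
    and p_obs: "\<And>n z. n \<ge> 1 \<Longrightarrow>
      p_obs n z = (\<integral>x. gaussian_density (H n *v x) (R n) z * p_forecast n x \<partial>lborel)"
    and p_dsm: "\<And>n x. n \<ge> 1 \<Longrightarrow>
      p_dsm n x = normalized (\<lambda>x. p_forecast n x *
        exp (- dsm_loss (w n) (gaussian_density (H n *v x) (R n)) (y n))) x"
  shows "\<forall>n\<ge>1.
      sym_posdef (Pf n) \<and> (\<forall>x. p_forecast n x = gaussian_density (mf n) (Pf n) x) \<and>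
      sym_posdef (\<Sigma> n) \<and> (\<forall>z. p_obs n z = gaussian_density (H n *v mf n) (\<Sigma> n) z) \<and>
      sym_posdef (Pa n) \<and> (\<forall>x. p_dsm n x = gaussian_density (ma n) (Pa n) x)"
proof -
  \<comment> \<open>One full cycle, from the analysis at \<open>n - 1\<close> to the forecast, the
    observation density and the analysis at \<open>n\<close>.\<close>
  have step: "sym_posdef (Pf n) \<and> (\<forall>x. p_forecast n x = gaussian_density (mf n) (Pf n) x) \<and>
      sym_posdef (\<Sigma> n) \<and> (\<forall>z. p_obs n z = gaussian_density (H n *v mf n) (\<Sigma> n) z) \<and>
      sym_posdef (Pa n) \<and> (\<forall>x. p_dsm n x = gaussian_density (ma n) (Pa n) x)"
    if n: "n \<ge> 1" and Pa_prev: "sym_posdef (Pa (n - 1))"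
      and dsm_prev: "\<And>x. p_dsm (n - 1) x = gaussian_density (ma (n - 1)) (Pa (n - 1)) x" for n
  proof -
    interpret fc: gaussian_update "Pa (n - 1)" "Q n" "A n"
      using Pa_prev Q[OF n] by unfold_locales
    have fcS: "fc.S = Pf n" unfolding fc.S_def Pf[OF n] ..
    have Pf_pd: "sym_posdef (Pf n)" using fc.sym_posdef_S unfolding fcS .
    have fcast: "p_forecast n x = gaussian_density (mf n) (Pf n) x" for x
      unfolding p_forecast[OF n] dsm_prev fc.integral_gaussian_density_mult fcS mf[OF n] ..

    interpret ob: gaussian_update "Pf n" "R n" "H n"
      using Pf_pd R[OF n] by unfold_locales
    have obS: "ob.S = \<Sigma> n" by (simp add: ob.S_def \<Sigma>[OF n])
    have \<Sigma>_pd: "sym_posdef (\<Sigma> n)" using ob.sym_posdef_S by (simp add: obS)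
    have obs: "p_obs n z = gaussian_density (H n *v mf n) (\<Sigma> n) z" for z
      by (simp add: p_obs[OF n] fcast ob.integral_gaussian_density_mult obS)

    define \<kappa> where "\<kappa> i z = k n (blk i) z" for i z
    have blk: "blk i \<in> {1..B}" for i using blocks by auto
    have k_pos: "k n (blk i) z > 0" for i z
    proof -
      have "1 + (norm (subvec blk (blk i) (msqrt (matrix_inv (\<Sigma> n)) *v (z - H n *v mf n))))\<^sup>2 / (q (blk i))\<^sup>2 > 0"
        by (intro add_pos_nonneg) simp_all
      then show ?thesis by (simp add: k[OF n blk])
    qed
    interpret df: diagonal_diffusion "R n" \<kappa> "y n"
    proof
      \<comment> \<open>Inside a block the weights coincide; across blocks the entry of
        \<open>R n\<close> is zero.\<close>
      show "\<kappa> i z * R n $ i $ j = R n $ i $ j * \<kappa> j z" for i j z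
        by (simp add: \<kappa>_def R_block[OF n] block_diag_def)
      show "\<exists>d. ((\<lambda>t. (\<kappa> i (y n + t *\<^sub>R axis i 1))\<^sup>2) has_real_derivative d) (at 0)" for i
        unfolding \<kappa>_def k[OF n blk] by (rule has_derivative_robust_weight)
    qed (simp_all add: R[OF n] \<kappa>_def k_pos)
    have D: "df.D z = kB n z" for z
      by (simp add: df.D_def kB[OF n] block_diag_scaled_identity \<kappa>_def)
    have wn: "df.w = w n"
      by (simp add: fun_eq_iff df.w_def w[OF n] D)
    have dN: "df.N = NB n (y n)"
      unfolding df.N_def NB[OF n] by (simp add: vec_eq_iff R_block[OF n] N[OF n blk] block_diag_def \<kappa>_def)
    have yt: "y n - 2 *\<^sub>R (NB n (y n) *v df.d) = ytilde n"
      by (simp add: ytilde[OF n] df.d_def D)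
    obtain c where c: "c > 0"
      "\<And>m. exp (- dsm_loss (w n) (gaussian_density m (R n)) (y n)) = c * gaussian_density m (NB n (y n)) (ytilde n)"
      using df.exp_dsm_loss unfolding wn dN yt by blast

    interpret an: gaussian_update "Pf n" "NB n (y n)" "H n"
      using Pf_pd df.sym_posdef_N[unfolded dN] by unfold_locales
    have anK: "an.K = K n"
      by (simp add: an.K_def an.S_def K[OF n] add.commute)
    have anP: "an.P' = Pa n"
      by (simp add: an.P'_def Pa[OF n] anK)
    have "p_dsm n x = gaussian_density (ma n) (Pa n) x" for x
    proof -
      have "p_dsm n x = normalized (\<lambda>x. c * (gaussian_density (H n *v x) (NB n (y n)) (ytilde n) * gaussian_density (mf n) (Pf n) x)) x"
        by (simp add: p_dsm[OF n] fcast c(2) mult_ac)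
      also have "\<dots> = gaussian_density (ma n) (Pa n) x"
        using c(1) by (simp add: an.normalized_gaussian_density_mult anK anP ma[OF n])
      finally show ?thesis .
    qed
    then show ?thesis
      using Pf_pd \<Sigma>_pd an.sym_posdef_P' fcast obs by (simp add: anP)
  qed
  \<comment> \<open>Only the analysis law is carried through the induction. It starts at time 0,
    where it is the initial law, whereas forecasts exist from time 1 on.\<close>
  have inv: "sym_posdef (Pa n) \<and> (\<forall>x. p_dsm n x = gaussian_density (ma n) (Pa n) x)" for n
  proof (induction n)
    case 0
    show ?case by (simp add: Pa_0 P0 p_dsm_0 ma_0)
  next
    case (Suc n)
    then show ?case using step[of "Suc n"] by simp
  qed
  show ?thesis
    by (intro allI impI step) (use inv in auto)
qed

end
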